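(* For any $\alpha = \mathrm{polylog}\, n$, the problem of computing an $\alpha$-approximate solution to distributed minimum set cover is $\mathsf{P}$-$\mathsf{SLOCAL}$-complete.
   Context: Minimum set cover: given a ground set $X$ and a collection $\mathcal S\subseteq 2^X$ covering $X$, find $\mathcal C\subseteq\mathcal S$ with $\bigcup_{A\in\mathcal C}A=X$ of minimum size; an $\alpha$-approximate solution is a cover of size at most $\alpha$ times the minimum. In the distributed version, the communication network is the bipartite graph with one node per element $x\in X$ and one per set $A\in\mathcal S$, with $x$ adjacent to $A$ iff $x\in A$; $n$ is its number of nodes. $\mathsf{P}$-$\mathsf{SLOCAL}$ is the class of problems solvable by a deterministic SLOCAL algorithm with locality $\mathrm{polylog}\, n$ (nodes processed sequentially in an arbitrary order, each reading its $\mathrm{polylog}\, n$-hop neighborhood including information stored by previously processed nodes). A problem $\mathcal A$ is $\mathsf{P}$-$\mathsf{SLOCAL}$-complete if $\mathcal A\in\mathsf{P}$-$\mathsf{SLOCAL}$ and, if $\mathcal A$ had a deterministic LOCAL algorithm with $\mathrm{polylog}\, n$ rounds, then every problem in $\mathsf{P}$-$\mathsf{SLOCAL}$ would have a deterministic LOCAL algorithm with $\mathrm{polylog}\, n$ rounds.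
   Formalization: The approximation factor α is also required to satisfy α(n) ≥ 1 for n ≥ 2 and α(n) ≥ 1 + 1/polylog n for large n; without this the claim fails, e.g. for α = 1, since exact minimum set cover on cycles is not in P-SLOCAL. *)

theory Defs
  imports Complex_Main "HOL-Library.FuncSet" "HOL-Library.Landau_Symbols"
begin

section \<open>Networks and distributed problems\<close>

text \<open>
  The nodes of a network are identified with their unique identifiers.  Inputs, outputs,
  messages and memory contents are finite data of unbounded size, coded as natural numbers.
\<close>

record network =
  verts :: "nat set"
  edges :: "nat set set"
  inp :: "nat \<Rightarrow> nat"

abbreviation size_of :: "network \<Rightarrow> nat" where
  "size_of G \<equiv> card (verts G)"

definition neighbors :: "network \<Rightarrow> nat \<Rightarrow> nat set" where
  "neighbors G v = {u. {v, u} \<in> edges G}"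

text \<open>Identifiers have \<open>O(log n)\<close> bits: they lie in \<open>{1..n ^ c}\<close> for a constant \<open>c\<close>.\<close>

definition network_ok :: "nat \<Rightarrow> network \<Rightarrow> bool" where
  "network_ok c G \<longleftrightarrow>
     finite (verts G) \<and>
     verts G \<subseteq> {1..size_of G ^ c} \<and>
     edges G \<subseteq> {{u, v} | u v. u \<in> verts G \<and> v \<in> verts G \<and> u \<noteq> v}"

definition hop_ball :: "network \<Rightarrow> nat \<Rightarrow> nat \<Rightarrow> nat set" where
  "hop_ball G r v = {u. \<exists>k\<le>r. (v, u) \<in> {(a, b). b \<in> neighbors G a} ^^ k}"

text \<open>
  A problem prescribes the admissible input-labelled networks and, for each of them, which
  output labellings are solutions.  It may refer to the identifiers, so that outputs can
  point to other nodes.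
\<close>

record problem =
  admissible :: "network \<Rightarrow> bool"
  solution :: "network \<Rightarrow> (nat \<Rightarrow> nat) \<Rightarrow> bool"

definition polylog :: "(nat \<Rightarrow> real) \<Rightarrow> bool" where
  "polylog f \<longleftrightarrow> (\<exists>k::nat. f \<in> O(\<lambda>n. ln (real n) ^ k))"

section \<open>The LOCAL model\<close>

text \<open>
  A node starts from \<open>n\<close>, its identifier and its input.  In each synchronous round it sends
  its whole state to all neighbors and computes its new state from its own state and the
  received ones.  As messages are unbounded and a state may contain the identifier of its
  owner, different messages for different neighbors are a special case.  The local
  computations are arbitrary functions.
\<close>

record local_alg =
  l_init :: "nat \<Rightarrow> nat \<Rightarrow> nat \<Rightarrow> nat"
  l_step :: "nat \<Rightarrow> nat set \<Rightarrow> nat"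
  l_out :: "nat \<Rightarrow> nat"

primrec local_state :: "local_alg \<Rightarrow> network \<Rightarrow> nat \<Rightarrow> nat \<Rightarrow> nat" where
  "local_state A G 0 v = l_init A (size_of G) v (inp G v)"
| "local_state A G (Suc t) v =
     l_step A (local_state A G t v) (local_state A G t ` neighbors G v)"

text \<open>Outputs are restricted to the nodes, so that only these matter for being a solution.\<close>

definition local_output :: "local_alg \<Rightarrow> nat \<Rightarrow> network \<Rightarrow> nat \<Rightarrow> nat" where
  "local_output A t G = restrict (\<lambda>v. l_out A (local_state A G t v)) (verts G)"

definition local_solves :: "nat \<Rightarrow> local_alg \<Rightarrow> (nat \<Rightarrow> nat) \<Rightarrow> problem \<Rightarrow> bool" where
  "local_solves c A T P \<longleftrightarrow>
     (\<forall>G. network_ok c G \<and> admissible P G \<longrightarrow>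
        solution P G (local_output A (T (size_of G)) G))"

definition P_LOCAL :: "problem set" where
  "P_LOCAL = {P. \<forall>c. \<exists>A T. polylog (\<lambda>n. real (T n)) \<and> local_solves c A T P}"

section \<open>The SLOCAL model\<close>

text \<open>
  When a node \<open>v\<close> is processed with locality \<open>r\<close>, it sees \<open>n\<close>, itself, the subgraph induced
  by its \<open>r\<close>-hop ball, the inputs in the ball and the memories of the nodes of the ball
  (\<^term>\<open>None\<close> for nodes that have not been processed yet).  From this it computes the
  content of its own memory, which determines its output and is never changed again.
\<close>

record view =
  view_n :: nat
  view_center :: nat
  view_verts :: "nat set"
  view_edges :: "nat set set"
  view_inp :: "nat \<Rightarrow> nat option"
  view_mem :: "nat \<Rightarrow> nat option"

definition view_of :: "network \<Rightarrow> nat \<Rightarrow> (nat \<Rightarrow> nat option) \<Rightarrow> nat \<Rightarrow> view" where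
  "view_of G r mem v =
     \<lparr>view_n = size_of G,
      view_center = v,
      view_verts = hop_ball G r v,
      view_edges = {e \<in> edges G. e \<subseteq> hop_ball G r v},
      view_inp = (Some \<circ> inp G) |` hop_ball G r v,
      view_mem = mem |` hop_ball G r v\<rparr>"

record slocal_alg =
  s_process :: "view \<Rightarrow> nat"
  s_out :: "nat \<Rightarrow> nat"

definition slocal_run :: "slocal_alg \<Rightarrow> nat \<Rightarrow> network \<Rightarrow> nat list \<Rightarrow> (nat \<Rightarrow> nat option)" where
  "slocal_run A r G order =
     foldl (\<lambda>mem v. mem(v \<mapsto> s_process A (view_of G r mem v))) Map.empty order"

definition slocal_output :: "slocal_alg \<Rightarrow> nat \<Rightarrow> network \<Rightarrow> nat list \<Rightarrow> nat \<Rightarrow> nat" where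
  "slocal_output A r G order =
     restrict (\<lambda>v. s_out A (the (slocal_run A r G order v))) (verts G)"

definition slocal_solves :: "nat \<Rightarrow> slocal_alg \<Rightarrow> (nat \<Rightarrow> nat) \<Rightarrow> problem \<Rightarrow> bool" where
  "slocal_solves c A R P \<longleftrightarrow>
     (\<forall>G order. network_ok c G \<and> admissible P G \<and> distinct order \<and> set order = verts G \<longrightarrow>
        solution P G (slocal_output A (R (size_of G)) G order))"

definition P_SLOCAL :: "problem set" where
  "P_SLOCAL = {P. \<forall>c. \<exists>A R. polylog (\<lambda>n. real (R n)) \<and> slocal_solves c A R P}"

definition P_SLOCAL_complete :: "problem \<Rightarrow> bool" where
  "P_SLOCAL_complete P \<longleftrightarrow> P \<in> P_SLOCAL \<and> (P \<in> P_LOCAL \<longrightarrow> (\<forall>Q\<in>P_SLOCAL. Q \<in> P_LOCAL))"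

section \<open>Minimum set cover\<close>

definition set_cover :: "'a set \<Rightarrow> 'a set set \<Rightarrow> 'a set set \<Rightarrow> bool" where
  "set_cover X S C \<longleftrightarrow> C \<subseteq> S \<and> \<Union>C = X"

definition min_cover_size :: "'a set \<Rightarrow> 'a set set \<Rightarrow> nat" where
  "min_cover_size X S = Min (card ` {C. set_cover X S C})"

definition approx_set_cover :: "real \<Rightarrow> 'a set \<Rightarrow> 'a set set \<Rightarrow> 'a set set \<Rightarrow> bool" where
  "approx_set_cover \<alpha> X S C \<longleftrightarrow>
     set_cover X S C \<and> real (card C) \<le> \<alpha> * real (min_cover_size X S)"

text \<open>
  Input 0 marks an element node and input 1 a set node.  Elements are identified with their
  nodes; a set node \<open>a\<close> stands for the set of the elements adjacent to it.  Since the sets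
  form a collection without repetitions, different set nodes stand for different sets.
\<close>

definition elem_nodes :: "network \<Rightarrow> nat set" where
  "elem_nodes G = {v \<in> verts G. inp G v = 0}"

definition set_nodes :: "network \<Rightarrow> nat set" where
  "set_nodes G = {v \<in> verts G. inp G v = 1}"

definition set_cover_network :: "network \<Rightarrow> bool" where
  "set_cover_network G \<longleftrightarrow>
     verts G = elem_nodes G \<union> set_nodes G \<and>
     edges G \<subseteq> {{x, a} | x a. x \<in> elem_nodes G \<and> a \<in> set_nodes G} \<and>
     inj_on (neighbors G) (set_nodes G) \<and>
     \<Union>(neighbors G ` set_nodes G) = elem_nodes G"

text \<open>A set node outputs 1 iff its set is chosen; the outputs of element nodes are irrelevant.\<close>

definition set_cover_problem :: "(nat \<Rightarrow> real) \<Rightarrow> problem" where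
  "set_cover_problem \<alpha> =
     \<lparr>admissible = set_cover_network,
      solution = (\<lambda>G y.
        approx_set_cover (\<alpha> (size_of G)) (elem_nodes G) (neighbors G ` set_nodes G)
          (neighbors G ` {a \<in> set_nodes G. y a = 1}))\<rparr>"

end

theory Submission
  imports Defs "HOL-Library.Nat_Bijection"
begin

text \<open>
  Completeness holds because P-SLOCAL is contained in P-LOCAL outright, by the deterministic
  network decomposition of Rozhon and Ghaffari.  Let \<open>k\<close> be the locality of an SLOCAL
  algorithm.  In the \<open>k\<close>-th power of the network every node starts as a cluster labelled by
  its identifier.  In the phase of bit \<open>i\<close> the clusters whose label has bit \<open>i\<close> set (blue)
  absorb adjacent nodes of the others (red) as long as they grow by a factor \<open>1 + 1 / 2b\<close>; a
  blue cluster that stops growing kills its few remaining proposers.  After all \<open>b = O(log n)\<close>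
  bits, adjacent living nodes carry the same label, labels lie within a polylogarithmic
  distance, and at least half of the nodes are alive.  Iterating on the dead nodes gives
  \<open>O(log n)\<close> colors, and the SLOCAL algorithm can be run color by color, all clusters of a
  color in parallel.

  For membership, every set node, when processed, grows a ball until the cost of covering its
  uncaptured elements increases by a factor of at most \<open>\<alpha>\<close> when the radius increases by 2, covers
  the larger ball optimally and captures it.  As \<open>\<alpha> \<ge> 1 + 1 / polylog n\<close>, this happens at a
  polylogarithmic radius, and no set of an optimal cover meets two of the smaller balls.
  A processed set node has all its elements captured, so its output can be fixed at once.
\<close>

section \<open>Balls and the gathering algorithm\<close>

lemma hop_ball_0 [simp]: "hop_ball G 0 v = {v}"
  by (auto simp: hop_ball_def)

lemma hop_ball_Suc: "hop_ball G (Suc r) v = insert v (\<Union>u\<in>neighbors G v. hop_ball G r u)"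
proof (intro set_eqI iffI)
  fix u assume "u \<in> hop_ball G (Suc r) v"
  then obtain l where l: "l \<le> Suc r" "(v, u) \<in> {(a, b). b \<in> neighbors G a} ^^ l"
    by (auto simp: hop_ball_def)
  show "u \<in> insert v (\<Union>u\<in>neighbors G v. hop_ball G r u)"
  proof (cases l)
    case 0
    then show ?thesis using l by simp
  next
    case (Suc m)
    then obtain w where "w \<in> neighbors G v" "(w, u) \<in> {(a, b). b \<in> neighbors G a} ^^ m"
      using l(2) relpow_Suc_E2[of v u m] unfolding Suc by blast
    then show ?thesis using l Suc by (auto simp: hop_ball_def)
  qed
next
  fix u assume "u \<in> insert v (\<Union>u\<in>neighbors G v. hop_ball G r u)"
  then consider "u = v" | w m where "w \<in> neighbors G v" "m \<le> r"
      "(w, u) \<in> {(a, b). b \<in> neighbors G a} ^^ m"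
    by (auto simp: hop_ball_def)
  then show "u \<in> hop_ball G (Suc r) v"
  proof cases
    case 1
    then show ?thesis by (auto simp: hop_ball_def intro!: exI[of _ 0])
  next
    case 2
    then have "(v, u) \<in> {(a, b). b \<in> neighbors G a} ^^ Suc m"
      by (intro relpow_Suc_I2[of v w]) auto
    then show ?thesis using 2 unfolding hop_ball_def by blast
  qed
qed

lemma hop_ball_self [simp]: "v \<in> hop_ball G r v"
  by (cases r) (auto simp: hop_ball_Suc)

lemma hop_ball_mono: "r \<le> s \<Longrightarrow> hop_ball G r v \<subseteq> hop_ball G s v"
  unfolding hop_ball_def using order_trans by blast

lemma hop_ball_trans:
  "u \<in> hop_ball G r v \<Longrightarrow> w \<in> hop_ball G s u \<Longrightarrow> w \<in> hop_ball G (r + s) v"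
proof -
  assume "u \<in> hop_ball G r v" "w \<in> hop_ball G s u"
  then obtain l m where "l \<le> r" "(v, u) \<in> {(a, b). b \<in> neighbors G a} ^^ l"
    "m \<le> s" "(u, w) \<in> {(a, b). b \<in> neighbors G a} ^^ m"
    by (auto simp: hop_ball_def)
  then have "(v, w) \<in> {(a, b). b \<in> neighbors G a} ^^ (l + m)" "l + m \<le> r + s"
    by (auto simp: relpow_add)
  then show ?thesis unfolding hop_ball_def by blast
qed

lemma neighbors_sym: "u \<in> neighbors G v \<longleftrightarrow> v \<in> neighbors G u"
  by (simp add: neighbors_def insert_commute)

lemma neighbors_hop_ball: "u \<in> neighbors G v \<Longrightarrow> u \<in> hop_ball G (Suc 0) v"
  by (simp add: hop_ball_Suc)

lemma hop_ball_sym: "u \<in> hop_ball G r v \<Longrightarrow> v \<in> hop_ball G r u"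
proof (induction r arbitrary: v)
  case (Suc r)
  show ?case
  proof (cases "u = v")
    case False
    then obtain w where w: "w \<in> neighbors G v" "u \<in> hop_ball G r w"
      using Suc.prems by (auto simp: hop_ball_Suc)
    have "v \<in> hop_ball G (r + Suc 0) u"
      using hop_ball_trans[OF Suc.IH[OF w(2)] neighbors_hop_ball] w(1) neighbors_sym by blast
    then show ?thesis by simp
  qed simp
qed simp

lemma neighbors_subset_verts: "network_ok c G \<Longrightarrow> neighbors G v \<subseteq> verts G"
  by (fastforce simp: network_ok_def neighbors_def doubleton_eq_iff)

lemma finite_verts: "network_ok c G \<Longrightarrow> finite (verts G)"
  by (simp add: network_ok_def)

lemma finite_neighbors: "network_ok c G \<Longrightarrow> finite (neighbors G v)"
  by (rule finite_subset[OF neighbors_subset_verts finite_verts])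

lemma hop_ball_subset_verts: "network_ok c G \<Longrightarrow> v \<in> verts G \<Longrightarrow> hop_ball G r v \<subseteq> verts G"
proof (induction r arbitrary: v)
  case (Suc r)
  then show ?case using neighbors_subset_verts[of c G v] by (fastforce simp: hop_ball_Suc)
qed simp

section \<open>Indistinguishability of two networks around a node\<close>

definition agree :: "nat \<Rightarrow> network \<Rightarrow> network \<Rightarrow> nat \<Rightarrow> bool" where
  "agree r G G' v \<longleftrightarrow> size_of G = size_of G' \<and>
     (\<forall>u\<in>hop_ball G r v. neighbors G u = neighbors G' u \<and> inp G u = inp G' u)"

text \<open>Triangle inequality for agreement: moving \<open>d\<close> hops away costs
  \<open>d\<close> of the radius. The locality estimates below add up such losses.\<close>

lemma agree_shift: "agree r G G' v \<Longrightarrow> u \<in> hop_ball G d v \<Longrightarrow> s + d \<le> r \<Longrightarrow> agree s G G' u"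
proof -
  assume *: "agree r G G' v" "u \<in> hop_ball G d v" "s + d \<le> r"
  have "w \<in> hop_ball G r v" if "w \<in> hop_ball G s u" for w
    using hop_ball_trans[OF *(2) that] hop_ball_mono[of "d + s" r G v] *(3)
    by (auto simp: add.commute)
  then show ?thesis using *(1) by (simp add: agree_def)
qed

lemma agree_mono: "agree r G G' v \<Longrightarrow> s \<le> r \<Longrightarrow> agree s G G' v"
  by (rule agree_shift[of r _ _ _ _ 0]) auto

text \<open>Agreement compares complete neighborhoods, including edges that leave the ball, so it
  fixes balls up to one hop beyond its radius.\<close>

lemma agree_hop_ball: "agree r G G' v \<Longrightarrow> s \<le> Suc r \<Longrightarrow> hop_ball G s v = hop_ball G' s v"
proof (induction s arbitrary: v r)
  case (Suc s)
  have N: "neighbors G v = neighbors G' v"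
    using Suc.prems(1) hop_ball_self by (auto simp: agree_def)
  have "hop_ball G s u = hop_ball G' s u" if "u \<in> neighbors G v" for u
  proof (cases s)
    case (Suc s')
    then have "agree s' G G' u"
      using agree_shift[OF Suc.prems(1) neighbors_hop_ball[OF that]] \<open>Suc s \<le> Suc r\<close> by simp
    then show ?thesis using Suc.IH Suc by blast
  qed simp
  then show ?case using N by (simp add: hop_ball_Suc)
qed simp

text \<open>The full-information protocol: a state keeps \<open>n\<close>, the owner's previous
  state and the set of received states, so nothing seen is lost. Since \<open>n\<close> comes first
  in every state, it can be read off without knowing the round.\<close>

definition gather :: "(nat \<Rightarrow> nat) \<Rightarrow> local_alg" where
  "gather out = \<lparr>
     l_init = (\<lambda>n v i. prod_encode (n, prod_encode (v, i))),
     l_step = (\<lambda>s M. prod_encode (fst (prod_decode s), prod_encode (s, set_encode M))),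
     l_out = out\<rparr>"

lemma gather_state_0:
  "local_state (gather out) G 0 v = prod_encode (size_of G, prod_encode (v, inp G v))"
  by (simp add: gather_def)

lemma gather_state_Suc:
  "local_state (gather out) G (Suc t) v = prod_encode (size_of G, prod_encode
     (local_state (gather out) G t v, set_encode (local_state (gather out) G t ` neighbors G v)))"
proof -
  have "fst (prod_decode (local_state (gather out) G t v)) = size_of G" for t v
    by (induction t) (simp_all add: gather_def)
  then show ?thesis by (simp add: gather_def)
qed

lemma gather_state_size: "fst (prod_decode (local_state (gather out) G t v)) = size_of G"
  by (cases t) (simp_all add: gather_state_0 gather_state_Suc del: local_state.simps)

text \<open>Unwinding the stored own states down to round 0 exposes the identifier and the
  input.\<close>

lemma gather_state_determines_node:
  assumes "network_ok c G" "network_ok c G'"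
    and "local_state (gather out) G t v = local_state (gather out) G' t v'"
  shows "v = v' \<and> inp G v = inp G' v"
  using assms(3)
  by (induction t)
    (auto simp: gather_state_0 gather_state_Suc simp del: local_state.simps)

text \<open>Received states form a set without sender names, but each state reveals its owner, so
  the set determines the neighborhood and the state of every neighbor. Learning the neighborhoods of
  nodes at distance \<open>r\<close> takes round \<open>r + 1\<close>.\<close>

lemma gather_state_determines_ball:
  assumes ok: "network_ok c G" "network_ok c G'"
  shows "local_state (gather out) G (Suc r) v = local_state (gather out) G' (Suc r) v \<Longrightarrow>
    agree r G G' v"
proof (induction r arbitrary: v)
  have N: "neighbors G v = neighbors G' v \<and>
      (\<forall>u\<in>neighbors G v. local_state (gather out) G t u = local_state (gather out) G' t u)"
    if "local_state (gather out) G (Suc t) v = local_state (gather out) G' (Suc t) v" for t v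
  proof -
    let ?f = "local_state (gather out) G t" and ?f' = "local_state (gather out) G' t"
    have im: "?f ` neighbors G v = ?f' ` neighbors G' v"
      using that finite_neighbors[OF ok(1)] finite_neighbors[OF ok(2)]
      by (simp add: gather_state_Suc set_encode_eq del: local_state.simps)
    have "u \<in> neighbors G' v \<and> ?f u = ?f' u" if "u \<in> neighbors G v" for u
    proof -
      from that im obtain w where "w \<in> neighbors G' v" "?f u = ?f' w" by blast
      then show ?thesis using gather_state_determines_node[OF ok] by metis
    qed
    moreover have "u \<in> neighbors G v" if "u \<in> neighbors G' v" for u
    proof -
      from that im obtain w where "w \<in> neighbors G v" "?f w = ?f' u" by (metis imageE imageI)
      then show ?thesis using gather_state_determines_node[OF ok] by metis
    qed
    ultimately show ?thesis by blast
  qed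
  have size: "size_of G = size_of G'"
    if "local_state (gather out) G t v = local_state (gather out) G' t v" for t v
    using that gather_state_size by metis
  {
    case 0
    then show ?case
      using N[OF 0] size[OF 0] gather_state_determines_node[OF ok 0] by (simp add: agree_def)
  next
    case (Suc r)
    have "agree r G G' u" if "u \<in> neighbors G v" for u
      using Suc.IH N[OF Suc.prems] that by blast
    then show ?case
      using N[OF Suc.prems] size[OF Suc.prems] gather_state_determines_node[OF ok Suc.prems]
      by (auto simp: agree_def hop_ball_Suc)
  }
qed

definition local_fun :: "nat \<Rightarrow> (nat \<Rightarrow> nat) \<Rightarrow> (network \<Rightarrow> nat \<Rightarrow> 'a) \<Rightarrow> bool" where
  "local_fun c r f \<longleftrightarrow> (\<forall>G G' v. network_ok c G \<and> network_ok c G' \<and>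
     v \<in> verts G \<and> v \<in> verts G' \<and> agree (r (size_of G)) G G' v \<longrightarrow> f G v = f G' v)"

text \<open>The output map inverts the gathered state up to indistinguishability by choice.\<close>

lemma local_fun_realizable:
  assumes "local_fun c r f"
  obtains A where "\<And>G v. network_ok c G \<Longrightarrow> v \<in> verts G \<Longrightarrow>
    l_out A (local_state A G (Suc (r (size_of G))) v) = f G v"
proof -
  define st where "st = (\<lambda>G v. local_state (gather undefined) G (Suc (r (size_of G))) v)"
  define P where "P = (\<lambda>s (G, v). network_ok c G \<and> v \<in> verts G \<and> st G v = s)"
  define out where "out = (\<lambda>s. case SOME p. P s p of (G, v) \<Rightarrow> f G v)"
  \<comment> \<open>The states do not depend on the output map. This resolves the apparent
    circularity that \<open>out\<close> is defined from states of \<open>gather\<close>.\<close>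
  have st: "local_state (gather out) G t v = local_state (gather undefined) G t v" for G t v
  proof (induction t arbitrary: v)
    case (Suc t)
    then have "local_state (gather out) G t = local_state (gather undefined) G t" by blast
    then show ?case by (simp add: gather_state_Suc del: local_state.simps)
  qed (simp add: gather_def)
  have "out (st G v) = f G v" if ok: "network_ok c G" "v \<in> verts G" for G v
  proof -
    obtain G' v' where G': "(SOME p. P (st G v) p) = (G', v')" by fastforce
    have "P (st G v) (G, v)" using ok by (simp add: P_def)
    then have "P (st G v) (G', v')" using someI[of "P (st G v)"] G' by metis
    then have ok': "network_ok c G'" "v' \<in> verts G'" and eq: "st G' v' = st G v"
      by (auto simp: P_def)
    have "size_of G = size_of G'"
      using eq gather_state_size unfolding st_def by metis
    then have eq': "local_state (gather undefined) G (Suc (r (size_of G))) v =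
        local_state (gather undefined) G' (Suc (r (size_of G))) v'"
      using eq unfolding st_def by simp
    with gather_state_determines_node[OF ok(1) ok'(1) eq'] have "v' = v" by simp
    moreover have "agree (r (size_of G)) G G' v"
      using gather_state_determines_ball[OF ok(1) ok'(1)] eq' \<open>v' = v\<close> by blast
    ultimately have "f G v = f G' v'"
      using assms ok ok' unfolding local_fun_def by blast
    then show ?thesis by (simp add: out_def G')
  qed
  then have "l_out (gather out) (local_state (gather out) G (Suc (r (size_of G))) v) = f G v"
    if "network_ok c G" "v \<in> verts G" for G v
    using that unfolding st st_def by (simp add: gather_def del: local_state.simps)
  then show ?thesis by (rule that)
qed

section \<open>Polylogarithmic functions\<close>

lemma eventually_ln_ge: "\<forall>\<^sub>F n in sequentially. C \<le> ln (real n)"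
  by (rule filterlim_compose[OF ln_at_top filterlim_real_sequentially,
        unfolded filterlim_at_top, rule_format])

text \<open>Since \<open>ln n\<close> eventually exceeds any constant, the constant hidden in the
  O-notation is absorbed by one more power.\<close>

lemma polylog_iff: "polylog f \<longleftrightarrow> (\<exists>k::nat. \<forall>\<^sub>F n in sequentially. \<bar>f n\<bar> \<le> ln (real n) ^ k)"
proof
  assume "polylog f"
  then obtain k C where "\<forall>\<^sub>F n in sequentially. norm (f n) \<le> C * norm (ln (real n) ^ k)"
    unfolding polylog_def bigo_def by auto
  then have "\<forall>\<^sub>F n in sequentially. \<bar>f n\<bar> \<le> ln (real n) ^ Suc k"
    using eventually_ln_ge[of "max 0 C"]
  proof eventually_elim
    case (elim n)
    have "\<bar>f n\<bar> \<le> C * ln (real n) ^ k" using elim by simp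
    also have "\<dots> \<le> ln (real n) * ln (real n) ^ k" using elim by (intro mult_right_mono) auto
    finally show ?case by simp
  qed
  then show "\<exists>k::nat. \<forall>\<^sub>F n in sequentially. \<bar>f n\<bar> \<le> ln (real n) ^ k" by blast
next
  assume "\<exists>k::nat. \<forall>\<^sub>F n in sequentially. \<bar>f n\<bar> \<le> ln (real n) ^ k"
  then obtain k where "\<forall>\<^sub>F n in sequentially. \<bar>f n\<bar> \<le> ln (real n) ^ k" by blast
  then have "\<forall>\<^sub>F n in sequentially. norm (f n) \<le> 1 * norm (ln (real n) ^ k)"
    using eventually_ln_ge[of 0] by eventually_elim simp
  then show "polylog f" unfolding polylog_def by (blast intro: bigoI)
qed

lemma polylog_mono:
  "polylog g \<Longrightarrow> \<forall>\<^sub>F n in sequentially. \<bar>f n\<bar> \<le> g n \<Longrightarrow> polylog f"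
proof -
  assume "polylog g" and le: "\<forall>\<^sub>F n in sequentially. \<bar>f n\<bar> \<le> g n"
  then obtain k where "\<forall>\<^sub>F n in sequentially. \<bar>g n\<bar> \<le> ln (real n) ^ k"
    unfolding polylog_iff by blast
  with le have "\<forall>\<^sub>F n in sequentially. \<bar>f n\<bar> \<le> ln (real n) ^ k"
    by eventually_elim linarith
  then show ?thesis unfolding polylog_iff by blast
qed

lemma polylog_ln_power: "polylog (\<lambda>n. ln (real n) ^ k)"
  unfolding polylog_def by (intro exI[of _ k]) simp

lemma polylog_const: "polylog (\<lambda>n. C)"
  unfolding polylog_iff using eventually_ln_ge[of "\<bar>C\<bar>"] by (intro exI[of _ 1]) simp

lemma polylog_mult:
  assumes "polylog f" "polylog g"
  shows "polylog (\<lambda>n. f n * g n)"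
proof -
  obtain k m where "\<forall>\<^sub>F n in sequentially. \<bar>f n\<bar> \<le> ln (real n) ^ k"
    "\<forall>\<^sub>F n in sequentially. \<bar>g n\<bar> \<le> ln (real n) ^ m"
    using assms unfolding polylog_iff by blast
  then have "\<forall>\<^sub>F n in sequentially. \<bar>f n * g n\<bar> \<le> ln (real n) ^ (k + m)"
    by eventually_elim (auto simp: abs_mult power_add intro!: mult_mono)
  then show ?thesis unfolding polylog_iff by blast
qed

text \<open>Reduces sums to products: |f + g| is at most (|f| + 1)(|g| + 1), and adding 1 costs only
  one more power of the logarithm.\<close>

lemma polylog_add:
  assumes "polylog f" "polylog g"
  shows "polylog (\<lambda>n. f n + g n)"
proof -
  have "polylog (\<lambda>n. \<bar>h n\<bar> + 1)" if h: "polylog h" for h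
  proof -
    obtain k where "\<forall>\<^sub>F n in sequentially. \<bar>h n\<bar> \<le> ln (real n) ^ k"
      using h unfolding polylog_iff by blast
    then have "\<forall>\<^sub>F n in sequentially. \<bar>\<bar>h n\<bar> + 1\<bar> \<le> ln (real n) ^ Suc k"
      using eventually_ln_ge[of 2]
    proof eventually_elim
      case (elim n)
      have "1 \<le> ln (real n) ^ k" using elim by (intro one_le_power) simp
      moreover have "2 * ln (real n) ^ k \<le> ln (real n) * ln (real n) ^ k"
        using elim by (intro mult_right_mono) auto
      ultimately show ?case using elim(1) unfolding power_Suc by linarith
    qed
    then show ?thesis unfolding polylog_iff by blast
  qed
  from polylog_mult[OF this[OF assms(1)] this[OF assms(2)]] show ?thesis
    by (rule polylog_mono)
      (auto simp: algebra_simps intro!: always_eventually abs_triangle_ineq[THEN order_trans])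
qed

definition lg :: "nat \<Rightarrow> nat" where
  "lg n = nat \<lceil>log 2 (real n)\<rceil>"

lemma le_two_power_lg: "n \<le> 2 ^ lg n"
proof (cases "n = 0")
  case False
  then have "real n = 2 powr log 2 (real n)" by simp
  also have "\<dots> \<le> 2 powr real (lg n)" unfolding lg_def by (intro powr_mono real_nat_ceiling_ge) simp
  also have "\<dots> = real (2 ^ lg n)" by (simp add: powr_realpow)
  finally show ?thesis by linarith
qed simp

lemma polylog_lg: "polylog (\<lambda>n. real (lg n))"
proof (rule polylog_mono)
  show "polylog (\<lambda>n. ln (real n) ^ 1 * (1 / ln 2) + 1)"
    by (intro polylog_add polylog_mult polylog_ln_power polylog_const)
  have "real (lg n) \<le> log 2 (real n) + 1" if "n \<ge> 1" for n
    using that by (simp add: lg_def)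
  then show "\<forall>\<^sub>F n in sequentially. \<bar>real (lg n)\<bar> \<le> ln (real n) ^ 1 * (1 / ln 2) + 1"
    by (auto simp: eventually_sequentially log_def)
qed

section \<open>Clustering half of the nodes\<close>

definition red :: "nat \<Rightarrow> (nat \<Rightarrow> nat option) \<Rightarrow> nat \<Rightarrow> bool" where
  "red i l v \<longleftrightarrow> (\<exists>y. l v = Some y \<and> \<not> bit y i)"

definition offers :: "(nat \<Rightarrow> nat set) \<Rightarrow> nat \<Rightarrow> (nat \<Rightarrow> nat option) \<Rightarrow> nat \<Rightarrow> nat set" where
  "offers N i l v = {x. bit x i \<and> (\<exists>u\<in>N v. l u = Some x)}"

definition members :: "nat set \<Rightarrow> (nat \<Rightarrow> nat option) \<Rightarrow> nat \<Rightarrow> nat set" where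
  "members V l x = {u\<in>V. l u = Some x}"

definition proposers ::
  "(nat \<Rightarrow> nat set) \<Rightarrow> nat set \<Rightarrow> nat \<Rightarrow> (nat \<Rightarrow> nat option) \<Rightarrow> nat \<Rightarrow> nat set" where
  "proposers N V i l x =
     {v\<in>V. red i l v \<and> offers N i l v \<noteq> {} \<and> (LEAST y. y \<in> offers N i l v) = x}"

text \<open>
  \<open>l\<close> maps a living node to the label of its cluster.  A red node that sees blue clusters
  proposes to one of them; a blue cluster absorbs its proposers if they are at least a
  \<open>1 / 2b\<close> fraction of it and kills them otherwise.
\<close>

definition cstep ::
  "(nat \<Rightarrow> nat set) \<Rightarrow> nat set \<Rightarrow> nat \<Rightarrow> nat \<Rightarrow> (nat \<Rightarrow> nat option) \<Rightarrow> nat \<Rightarrow> nat option" where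
  "cstep N V b i l v =
     (if red i l v \<and> offers N i l v \<noteq> {} then
        let x = (LEAST y. y \<in> offers N i l v) in
        if card (members V l x) \<le> 2 * b * card (proposers N V i l x) then Some x else None
      else l v)"

definition quiet :: "(nat \<Rightarrow> nat set) \<Rightarrow> nat set \<Rightarrow> nat \<Rightarrow> (nat \<Rightarrow> nat option) \<Rightarrow> nat \<Rightarrow> bool" where
  "quiet N V i l x \<longleftrightarrow> (\<forall>v\<in>V. red i l v \<longrightarrow> x \<notin> offers N i l v)"

text \<open>These nodes pay for the killed ones: a cluster that kills becomes quiet in that very
  step and stays quiet for the rest of the phase.\<close>

definition finished :: "(nat \<Rightarrow> nat set) \<Rightarrow> nat set \<Rightarrow> nat \<Rightarrow> (nat \<Rightarrow> nat option) \<Rightarrow> nat set" where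
  "finished N V i l = {v\<in>V. \<exists>x. l v = Some x \<and> bit x i \<and> quiet N V i l x}"

definition bits_agree :: "(nat \<Rightarrow> nat set) \<Rightarrow> nat set \<Rightarrow> nat \<Rightarrow> (nat \<Rightarrow> nat option) \<Rightarrow> bool" where
  "bits_agree N V i l \<longleftrightarrow> (\<forall>u\<in>V. \<forall>v\<in>N u. \<forall>x y. l u = Some x \<longrightarrow> l v = Some y \<longrightarrow>
     (\<forall>j<i. bit x j = bit y j))"

lemma Least_offer: "offers N i l v \<noteq> {} \<Longrightarrow> (LEAST y. y \<in> offers N i l v) \<in> offers N i l v"
  by (metis LeastI ex_in_conv)

lemma cstep_cases:
  obtains (same) "\<not> (red i l v \<and> offers N i l v \<noteq> {})" "cstep N V b i l v = l v"
  | (join) x where "red i l v" "x \<in> offers N i l v" "x = (LEAST y. y \<in> offers N i l v)"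
      "card (members V l x) \<le> 2 * b * card (proposers N V i l x)" "cstep N V b i l v = Some x"
  | (kill) x where "red i l v" "x \<in> offers N i l v" "x = (LEAST y. y \<in> offers N i l v)"
      "card (members V l x) > 2 * b * card (proposers N V i l x)" "cstep N V b i l v = None"
proof (cases "red i l v \<and> offers N i l v \<noteq> {}")
  case True
  then show ?thesis
    using join[OF _ Least_offer refl] kill[OF _ Least_offer refl]
    by (simp add: cstep_def Let_def not_le split: if_splits) (meson not_le)
next
  case False
  then show ?thesis by (intro same) (auto simp: cstep_def)
qed

text \<open>A red node with an offer turns blue or dies, and no node ever turns red.\<close>

lemma red_cstep: "red i (cstep N V b i l) v \<Longrightarrow> red i l v \<and> offers N i l v = {} \<and> cstep N V b i l v = l v"
  by (cases rule: cstep_cases[of i l v N V b]) (auto simp: red_def offers_def)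

lemma members_cstep:
  assumes "bit x i"
  shows "members V (cstep N V b i l) x = members V l x \<union>
    (if card (members V l x) \<le> 2 * b * card (proposers N V i l x) then proposers N V i l x else {})"
proof -
  have "v \<in> members V (cstep N V b i l) x \<longleftrightarrow> v \<in> members V l x \<union>
    (if card (members V l x) \<le> 2 * b * card (proposers N V i l x) then proposers N V i l x else {})"
    if "v \<in> V" for v
  proof (cases rule: cstep_cases[of i l v N V b])
    case same
    then show ?thesis using that by (auto simp: members_def proposers_def)
  next
    case (join y)
    then show ?thesis using that assms by (auto simp: members_def proposers_def red_def)
  next
    case (kill y)
    then show ?thesis using that assms by (auto simp: members_def proposers_def red_def)
  qed
  then show ?thesis by (auto simp: members_def proposers_def)
qed

text \<open>A red node that sees \<open>x\<close> after the step sees it through a member that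
  \<open>x\<close> already had before. Then it had an offer and cannot have stayed red.\<close>

lemma stalled_quiet:
  assumes N: "\<And>v. v \<in> V \<Longrightarrow> N v \<subseteq> V"
    and x: "bit x i" "members V (cstep N V b i l) x = members V l x"
  shows "quiet N V i (cstep N V b i l) x"
  unfolding quiet_def
proof (intro ballI impI notI)
  fix v assume v: "v \<in> V" "red i (cstep N V b i l) v" "x \<in> offers N i (cstep N V b i l) v"
  then obtain u where u: "u \<in> N v" "cstep N V b i l u = Some x" by (auto simp: offers_def)
  then have "u \<in> members V l x" using x N v(1) by (auto simp: members_def)
  then have "x \<in> offers N i l v" using u x by (auto simp: members_def offers_def)
  then show False using red_cstep v(2) by blast
qed

lemma quiet_proposers: "bit x i \<Longrightarrow> quiet N V i l x \<Longrightarrow> proposers N V i l x = {}"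
  using Least_offer by (fastforce simp: quiet_def proposers_def)

lemma quiet_cstep:
  assumes "\<And>v. v \<in> V \<Longrightarrow> N v \<subseteq> V" "bit x i" "quiet N V i l x"
  shows "quiet N V i (cstep N V b i l) x"
  by (rule stalled_quiet[OF assms(1,2)])
    (use members_cstep[OF assms(2), of V N b l] quiet_proposers[OF assms(2,3)] in simp_all)

text \<open>The charging argument. A cluster that kills \<open>p\<close> proposers has more than
  \<open>2 * b * p\<close> members and stalls, so all of these become finished now. They were not
  finished before, since a quiet cluster has no proposers; hence no node pays twice.\<close>

lemma killed_cstep:
  assumes "finite V" and N: "\<And>v. v \<in> V \<Longrightarrow> N v \<subseteq> V" and l: "dom l \<subseteq> V"
  shows "2 * b * card (dom l - dom (cstep N V b i l)) + card (finished N V i l)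
    \<le> card (finished N V i (cstep N V b i l))"
proof -
  let ?l' = "cstep N V b i l"
  define X where "X = {x. bit x i \<and> proposers N V i l x \<noteq> {} \<and>
    2 * b * card (proposers N V i l x) < card (members V l x)}"
  have "X \<subseteq> (\<lambda>v. LEAST y. y \<in> offers N i l v) ` V" by (auto simp: X_def proposers_def)
  then have X: "finite X" using assms(1) finite_subset by blast
  have fin: "finite (members V l x)" "finite (proposers N V i l x)" for x
    using assms(1) by (auto simp: members_def proposers_def)
  have killed: "dom l - dom ?l' \<subseteq> (\<Union>x\<in>X. proposers N V i l x)"
  proof
    fix v assume v: "v \<in> dom l - dom ?l'"
    then have "v \<in> V" using l by blast
    show "v \<in> (\<Union>x\<in>X. proposers N V i l x)"
    proof (cases rule: cstep_cases[of i l v N V b])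
      case (kill x)
      then have "v \<in> proposers N V i l x" using \<open>v \<in> V\<close> by (auto simp: proposers_def)
      then show ?thesis using kill by (auto simp: X_def offers_def)
    qed (use v in \<open>auto simp: dom_def\<close>)
  qed
  have "2 * b * card (dom l - dom ?l') \<le> 2 * b * (\<Sum>x\<in>X. card (proposers N V i l x))"
    using card_mono[OF _ killed] card_UN_le[OF X, of "proposers N V i l"] X fin
    by (intro mult_left_mono) (auto intro: order_trans)
  also have "\<dots> \<le> (\<Sum>x\<in>X. card (members V l x))"
    unfolding sum_distrib_left by (intro sum_mono) (auto simp: X_def)
  also have "\<dots> = card (\<Union>x\<in>X. members V l x)"
    using X fin by (intro card_UN_disjoint[symmetric]) (auto simp: members_def)
  finally have le: "2 * b * card (dom l - dom ?l') \<le> card (\<Union>x\<in>X. members V l x)" .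
  have same: "members V ?l' x = members V l x" if "x \<in> X" for x
    using that members_cstep[of x i V N b l] by (auto simp: X_def)
  have 1: "(\<Union>x\<in>X. members V l x) \<subseteq> finished N V i ?l'"
  proof
    fix v assume "v \<in> (\<Union>x\<in>X. members V l x)"
    then obtain x where x: "x \<in> X" "v \<in> members V l x" by blast
    then have "v \<in> members V ?l' x" "bit x i" using same by (auto simp: X_def)
    then show "v \<in> finished N V i ?l'"
      using stalled_quiet[OF N, where x = x and i = i and b = b and l = l] same[OF x(1)] by (auto simp: finished_def members_def)
  qed
  have 2: "finished N V i l \<subseteq> finished N V i ?l'"
  proof
    fix v assume "v \<in> finished N V i l"
    then obtain x where x: "v \<in> V" "l v = Some x" "bit x i" "quiet N V i l x"
      by (auto simp: finished_def)
    then have "\<not> red i l v" by (simp add: red_def)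
    then have "?l' v = Some x" using x by (simp add: cstep_def)
    then show "v \<in> finished N V i ?l'"
      using x quiet_cstep[OF N] by (auto simp: finished_def)
  qed
  have 3: "(\<Union>x\<in>X. members V l x) \<inter> finished N V i l = {}"
    using quiet_proposers by (fastforce simp: X_def finished_def members_def)
  have finf: "finite (finished N V i l)" "finite (finished N V i ?l')"
    using assms(1) by (auto simp: finished_def)
  have "card (\<Union>x\<in>X. members V l x) + card (finished N V i l) \<le> card (finished N V i ?l')"
    using card_Un_disjoint[OF _ finf(1) 3] card_mono[OF finf(2), of "(\<Union>x\<in>X. members V l x) \<union> finished N V i l"]
      1 2 X fin by simp
  then show ?thesis using le by simp
qed

lemma dom_cstep: "dom (cstep N V b i l) \<subseteq> dom l"
proof
  fix v assume "v \<in> dom (cstep N V b i l)"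
  then show "v \<in> dom l"
    by (cases rule: cstep_cases[of i l v N V b]) (auto simp: red_def dom_def)
qed

text \<open>A node changes its label only to that of an adjacent node, and the two agree below bit
  \<open>i\<close>. So the lower bits of a living node's label never change during the
  phase.\<close>

lemma bits_agree_cstep:
  assumes "bits_agree N V i l" "dom l \<subseteq> V" "\<And>v. v \<in> V \<Longrightarrow> N v \<subseteq> V"
  shows "bits_agree N V i (cstep N V b i l)"
proof -
  have low: "\<exists>x. l v = Some x \<and> (\<forall>j<i. bit x j = bit x' j)"
    if "cstep N V b i l v = Some x'" "v \<in> V" for v x'
  proof (cases rule: cstep_cases[of i l v N V b])
    case same
    then have "l v = Some x'" using that by simp
    then show ?thesis by blast
  next
    case (join x)
    obtain y u where y: "l v = Some y" "u \<in> N v" "l u = Some x"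
      using join(1,2) unfolding red_def offers_def by blast
    have "x' = x" using join(5) that(1) by simp
    with y show ?thesis using assms(1) that(2) unfolding bits_agree_def by blast
  next
    case kill
    then show ?thesis using that by simp
  qed
  show ?thesis
    unfolding bits_agree_def
  proof (intro ballI allI impI)
    fix u v x y j
    assume *: "u \<in> V" "v \<in> N u" "cstep N V b i l u = Some x" "cstep N V b i l v = Some y" "j < i"
    then have "v \<in> V" using assms(3) by blast
    obtain x' y' where "l u = Some x'" "\<forall>j<i. bit x' j = bit x j" "l v = Some y'" "\<forall>j<i. bit y' j = bit y j"
      using low * \<open>v \<in> V\<close> by metis
    then show "bit x j = bit y j" using assms(1) * unfolding bits_agree_def by metis
  qed
qed

text \<open>The size bound (1 + 1 / 2b)^t with denominators cleared. A step without growth leaves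
  the cluster quiet for good, and a cluster that is not quiet has at least one member to start
  from.\<close>

lemma phase_growth:
  assumes "finite V" and N: "\<And>v. v \<in> V \<Longrightarrow> N v \<subseteq> V" and "bit x i"
  shows "quiet N V i ((cstep N V b i ^^ t) l) x \<or>
    (2 * b + 1) ^ t \<le> card (members V ((cstep N V b i ^^ t) l) x) * (2 * b) ^ t"
proof (induction t)
  case 0
  have "0 < card (members V l x)" if "\<not> quiet N V i l x"
  proof -
    obtain v u where "v \<in> V" "u \<in> N v" "l u = Some x" using \<open>\<not> quiet N V i l x\<close> by (auto simp: quiet_def offers_def)
    then have "u \<in> members V l x" using N by (auto simp: members_def)
    then show ?thesis using assms(1) by (auto simp: card_gt_0_iff members_def)
  qed
  then show ?case by (cases "quiet N V i l x") (auto simp: Suc_le_eq)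
next
  case (Suc t)
  let ?l = "(cstep N V b i ^^ t) l"
  let ?m = "card (members V ?l x)" and ?p = "card (proposers N V i ?l x)"
  show ?case
  proof (cases "quiet N V i ?l x \<or> proposers N V i ?l x = {} \<or> 2 * b * ?p < ?m")
    case True
    then have "quiet N V i (cstep N V b i ?l) x"
      using stalled_quiet[OF N assms(3)] members_cstep[OF assms(3), of V N b ?l] quiet_cstep[OF N assms(3)]
      by fastforce
    then show ?thesis by simp
  next
    case False
    have "members V ?l x \<inter> proposers N V i ?l x = {}"
      using assms(3) by (auto simp: members_def proposers_def red_def)
    then have "card (members V (cstep N V b i ?l) x) = ?m + ?p"
      using False assms(1) members_cstep[OF assms(3), of V N b ?l]
      by (subst card_Un_disjoint[symmetric]) (auto simp: members_def proposers_def)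
    moreover have "(2 * b + 1) ^ Suc t \<le> (?m + ?p) * (2 * b) ^ Suc t"
    proof -
      have "(2 * b + 1) ^ t \<le> ?m * (2 * b) ^ t" using Suc False by blast
      then have "(2 * b + 1) ^ Suc t \<le> ((2 * b + 1) * ?m) * (2 * b) ^ t"
        by (metis mult.assoc mult_le_mono2 power_Suc)
      \<comment> \<open>A cluster that absorbs satisfies m \<le> 2bp, hence (2b + 1)m \<le> 2b(m +
        p).\<close>
      also have "\<dots> \<le> ((?m + ?p) * (2 * b)) * (2 * b) ^ t"
        using False by (intro mult_le_mono1) (simp add: algebra_simps)
      finally show ?thesis by (simp only: power_Suc mult.assoc)
    qed
    ultimately show ?thesis unfolding funpow.simps o_apply by metis
  qed
qed

text \<open>By hypothesis \<open>T\<close> the growth bound exceeds the number of nodes, so after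
  \<open>T\<close> steps every blue cluster is quiet and bit \<open>i\<close> agrees along edges.
  Deaths are paid by finished nodes, all alive at the start of the phase, so at most a fraction 1 /
  2b dies.\<close>

lemma phase:
  assumes fin: "finite V" and N: "\<And>v. v \<in> V \<Longrightarrow> N v \<subseteq> V"
    and sym: "\<And>u v. u \<in> V \<Longrightarrow> v \<in> N u \<Longrightarrow> u \<in> N v"
    and l: "dom l \<subseteq> V" "bits_agree N V i l"
    and T: "card V * (2 * b) ^ T < (2 * b + 1) ^ T"
  shows "dom ((cstep N V b i ^^ T) l) \<subseteq> dom l"
    and "bits_agree N V (Suc i) ((cstep N V b i ^^ T) l)"
    and "2 * b * card (dom l) \<le> 2 * b * card (dom ((cstep N V b i ^^ T) l)) + card (dom l)"
proof -
  have dom: "dom ((cstep N V b i ^^ t) l) \<subseteq> dom l" for t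
    by (induction t) (use dom_cstep in \<open>fastforce+\<close>)
  show "dom ((cstep N V b i ^^ T) l) \<subseteq> dom l" by (rule dom)
  have "finite (dom l)" using fin l finite_subset by blast
  have killed: "2 * b * card (dom l - dom ((cstep N V b i ^^ t) l)) \<le> card (finished N V i ((cstep N V b i ^^ t) l))" for t
  proof (induction t)
    case (Suc t)
    let ?l = "(cstep N V b i ^^ t) l"
    have "card (dom l - dom (cstep N V b i ?l)) \<le> card ((dom l - dom ?l) \<union> (dom ?l - dom (cstep N V b i ?l)))"
      using \<open>finite (dom l)\<close> dom[of t] by (intro card_mono) (auto intro: finite_subset)
    also have "\<dots> \<le> card (dom l - dom ?l) + card (dom ?l - dom (cstep N V b i ?l))"
      by (rule card_Un_le)
    finally have "2 * b * card (dom l - dom (cstep N V b i ?l)) \<le>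
        2 * b * card (dom l - dom ?l) + 2 * b * card (dom ?l - dom (cstep N V b i ?l))"
      by (metis add_mult_distrib2 mult_le_mono2)
    also have "\<dots> \<le> card (finished N V i (cstep N V b i ?l))"
      using Suc killed_cstep[OF fin N, where l = ?l and b = b and i = i] dom[of t] l by fastforce
    finally show ?case by simp
  qed simp
  let ?l = "(cstep N V b i ^^ T) l"
  have "finished N V i ?l \<subseteq> dom l" using dom[of T] by (auto simp: finished_def)
  then have "2 * b * card (dom l - dom ?l) \<le> card (dom l)"
    using killed[of T] card_mono[OF \<open>finite (dom l)\<close>] by (meson le_trans)
  moreover have "card (dom l - dom ?l) = card (dom l) - card (dom ?l)"
    using dom[of T] \<open>finite (dom l)\<close> by (meson card_Diff_subset finite_subset)
  ultimately show "2 * b * card (dom l) \<le> 2 * b * card (dom ?l) + card (dom l)"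
    by (simp add: diff_mult_distrib2)
  have "bits_agree N V i ((cstep N V b i ^^ t) l)" for t
  proof (induction t)
    case (Suc t)
    then show ?case using bits_agree_cstep[OF Suc _ N] dom[of t] l by simp
  qed (use l in simp)
  then have low: "bits_agree N V i ?l" .
  have quiet: "quiet N V i ?l x" if "bit x i" for x
  proof (rule ccontr)
    assume "\<not> ?thesis"
    then have "(2 * b + 1) ^ T \<le> card (members V ?l x) * (2 * b) ^ T"
      using phase_growth[where N = N, OF fin N that] by blast
    also have "\<dots> \<le> card V * (2 * b) ^ T"
      using fin by (intro mult_le_mono1 card_mono) (auto simp: members_def)
    finally show False using T by simp
  qed
  \<comment> \<open>Otherwise one endpoint is red and sees the blue cluster of the other, which is
    then not quiet. If the red one is \<open>v\<close>, the symmetry of \<open>N\<close> provides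
    the offer.\<close>
  have "bit x i = bit y i" if "u \<in> V" "v \<in> N u" "?l u = Some x" "?l v = Some y" for u v x y
  proof (rule ccontr)
    assume "bit x i \<noteq> bit y i"
    then consider "bit x i" "\<not> bit y i" | "\<not> bit x i" "bit y i" by blast
    then show False
    proof cases
      case 1
      then have "red i ?l v" "x \<in> offers N i ?l v" "v \<in> V"
        using that sym N by (auto simp: red_def offers_def)
      then show False using quiet[OF 1(1)] by (simp add: quiet_def)
    next
      case 2
      then have "red i ?l u" "y \<in> offers N i ?l u" using that by (auto simp: red_def offers_def)
      then show False using quiet[OF 2(2)] that(1) by (simp add: quiet_def)
    qed
  qed
  then show "bits_agree N V (Suc i) ?l"
    using low unfolding bits_agree_def less_Suc_eq by blast
qed

text \<open>Step \<open>s\<close> treats bit \<open>s div T\<close>, so a single counter runs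
  through all phases of \<open>T\<close> steps each.\<close>

primrec clustering ::
  "(nat \<Rightarrow> nat set) \<Rightarrow> nat set \<Rightarrow> nat \<Rightarrow> nat \<Rightarrow> nat set \<Rightarrow> nat \<Rightarrow> nat \<Rightarrow> nat option" where
  "clustering N V b T S 0 = (\<lambda>v. if v \<in> S then Some v else None)"
| "clustering N V b T S (Suc s) = cstep N V b (s div T) (clustering N V b T S s)"

lemma clustering_phase:
  "t \<le> T \<Longrightarrow> clustering N V b T S (i * T + t) = (cstep N V b i ^^ t) (clustering N V b T S (i * T))"
proof (induction t)
  case (Suc t)
  then have "(i * T + t) div T = i" by (simp add: div_nat_eqI)
  then show ?case using Suc by simp
qed simp

lemma clustering_half:
  assumes fin: "finite V" and N: "\<And>v. v \<in> V \<Longrightarrow> N v \<subseteq> V"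
    and sym: "\<And>u v. u \<in> V \<Longrightarrow> v \<in> N u \<Longrightarrow> u \<in> N v"
    and S: "S \<subseteq> V"
    and T: "card V * (2 * b) ^ T < (2 * b + 1) ^ T"
    and b: "b > 0"
  shows "bits_agree N V b (clustering N V b T S (b * T))"
    and "card S \<le> 2 * card (dom (clustering N V b T S (b * T)))"
proof -
  \<comment> \<open>A phase kills at most a fraction 1 / 2b of the living nodes, hence at most card
    S / 2b nodes, so \<open>b\<close> phases kill at most half of \<open>S\<close>.\<close>
  have *: "dom (clustering N V b T S (i * T)) \<subseteq> S \<and> bits_agree N V i (clustering N V b T S (i * T)) \<and>
    2 * b * card S \<le> 2 * b * card (dom (clustering N V b T S (i * T))) + i * card S" for i
  proof (induction i)
    case 0
    have "dom (\<lambda>v. if v \<in> S then Some v else None) = S" by (auto simp: dom_def)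
    then show ?case by (simp add: bits_agree_def)
  next
    case (Suc i)
    let ?l = "clustering N V b T S (i * T)"
    have eq: "clustering N V b T S (Suc i * T) = (cstep N V b i ^^ T) ?l"
      using clustering_phase[of T T N V b S i] by (simp add: add.commute)
    have "dom ?l \<subseteq> V" "bits_agree N V i ?l" using Suc S by auto
    note ph = phase[where b = b, OF fin N sym this T]
    have "card (dom ?l) \<le> card S" using Suc S fin finite_subset card_mono by metis
    then show ?case using ph Suc unfolding eq by auto
  qed
  show "bits_agree N V b (clustering N V b T S (b * T))" using * by blast
  have "b * (2 * card S) \<le> b * (2 * card (dom (clustering N V b T S (b * T))) + card S)"
    using *[of b] by (simp add: algebra_simps)
  then have "2 * card S \<le> 2 * card (dom (clustering N V b T S (b * T))) + card S"
    using b by simp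
  then show "card S \<le> 2 * card (dom (clustering N V b T S (b * T)))" by simp
qed

section \<open>Network decomposition and its locality\<close>

lemma agree_sym: "agree r G G' v \<Longrightarrow> agree r G' G v"
  using agree_hop_ball[of r G G' v r, symmetric] unfolding agree_def by (metis le_SucI order_refl)

lemma dom_clustering: "dom (clustering N V b T S s) \<subseteq> S"
proof (induction s)
  case (Suc s)
  then show ?case using dom_cstep by fastforce
qed (auto split: if_splits)

text \<open>A label starts as the identifier of its owner, and each step passes it on over at most
  \<open>k\<close> hops. So a cluster lies around the node named by its label.\<close>

lemma clustering_label_near:
  "clustering (hop_ball G k) V b T S s v = Some x \<Longrightarrow> x \<in> hop_ball G (k * s) v"
proof (induction s arbitrary: v x)
  case 0
  then show ?case by (simp split: if_splits)
next
  case (Suc s)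
  let ?l = "clustering (hop_ball G k) V b T S s"
  show ?case
  proof (cases rule: cstep_cases[of "s div T" ?l v "hop_ball G k" V b])
    case same
    then have "x \<in> hop_ball G (k * s) v" using Suc by simp
    then show ?thesis using hop_ball_mono[of "k * s" "k * Suc s" G v] by auto
  next
    case (join y)
    then have "y = x" using Suc.prems by simp
    then obtain u where "u \<in> hop_ball G k v" "?l u = Some x" using join(2) by (auto simp: offers_def)
    then show ?thesis using Suc.IH hop_ball_trans by fastforce
  next
    case kill
    then show ?thesis using Suc.prems by simp
  qed
qed

context
  fixes c k s i b D :: nat and G G' :: network and l l' :: "nat \<Rightarrow> nat option" and v :: nat
  assumes ok: "network_ok c G" "network_ok c G'"
    and v: "v \<in> verts G" "v \<in> verts G'"
    and near: "\<And>u x. l u = Some x \<Longrightarrow> x \<in> hop_ball G (k * s) u"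
    and D: "3 * k * (s + 1) \<le> D"
    and agree: "agree D G G' v"
    and l: "\<And>u. u \<in> hop_ball G D v \<Longrightarrow> l u = l' u"
begin

lemma offers_local:
  assumes "u \<in> hop_ball G r v" "r + k \<le> D"
  shows "offers (hop_ball G k) i l u = offers (hop_ball G' k) i l' u"
proof -
  have "hop_ball G k u = hop_ball G' k u"
    using agree_hop_ball[OF agree_shift[OF agree assms(1), of k], of k] assms(2) by simp
  moreover have "l w = l' w" if "w \<in> hop_ball G k u" for w
    using l hop_ball_trans[OF assms(1) that] hop_ball_mono[OF assms(2)] by blast
  ultimately show ?thesis by (auto simp: offers_def)
qed

lemma members_local:
  assumes "x \<in> hop_ball G (k + k * s) v"
  shows "members (verts G) l x \<subseteq> members (verts G') l' x"
proof
  fix w assume "w \<in> members (verts G) l x"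
  then have w: "l w = Some x" by (simp add: members_def)
  have "w \<in> hop_ball G (k + k * s + k * s) v"
    by (rule hop_ball_trans[OF assms hop_ball_sym[OF near[OF w]]])
  then have "w \<in> hop_ball G D v"
    using hop_ball_mono[of "k + k * s + k * s" D] D by (auto simp: algebra_simps)
  moreover from this have "w \<in> verts G'"
    using agree_hop_ball[OF agree, of D] hop_ball_subset_verts[OF ok(2) v(2)] by auto
  ultimately show "w \<in> members (verts G') l' x" using l w by (simp add: members_def)
qed

text \<open>From \<open>v\<close> it is \<open>k + k * s\<close> hops to \<open>x\<close>,
  \<open>k * s\<close> to the member of \<open>x\<close> that the proposer sees, and
  \<open>k\<close> to the proposer. Its own offers lie \<open>k\<close> further out, and the total
  3k + 2ks is at most \<open>D\<close>.\<close>

lemma proposers_local: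
  assumes "x \<in> hop_ball G (k + k * s) v"
  shows "proposers (hop_ball G k) (verts G) i l x \<subseteq> proposers (hop_ball G' k) (verts G') i l' x"
proof
  fix w assume w: "w \<in> proposers (hop_ball G k) (verts G) i l x"
  then have "x \<in> offers (hop_ball G k) i l w"
    using Least_offer[of "hop_ball G k" i l w] by (auto simp: proposers_def)
  then obtain u where u: "u \<in> hop_ball G k w" "l u = Some x" by (auto simp: offers_def)
  have "u \<in> hop_ball G (k + k * s + k * s) v"
    by (rule hop_ball_trans[OF assms hop_ball_sym[OF near[OF u(2)]]])
  then have far: "w \<in> hop_ball G (k + k * s + k * s + k) v"
    by (rule hop_ball_trans[OF _ hop_ball_sym[OF u(1)]])
  have le: "k + k * s + k * s + k + k \<le> D" using D by (simp add: algebra_simps)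
  have "w \<in> hop_ball G D v"
    using far hop_ball_mono[of "k + k * s + k * s + k" D G v] le by auto
  moreover from this have "w \<in> verts G'"
    using agree_hop_ball[OF agree, of D] hop_ball_subset_verts[OF ok(2) v(2)] by auto
  ultimately show "w \<in> proposers (hop_ball G' k) (verts G') i l' x"
    using w l offers_local[OF far le] by (simp add: proposers_def red_def)
qed

end

text \<open>A node decides by the size of the cluster it proposes to and the number of that
  cluster's proposers. The preceding inclusions, applied in both directions, equate these sets in
  the two networks.\<close>

lemma cstep_local:
  assumes ok: "network_ok c G" "network_ok c G'"
    and v: "v \<in> verts G" "v \<in> verts G'"
    and near: "\<And>u x. l u = Some x \<Longrightarrow> x \<in> hop_ball G (k * s) u"
      "\<And>u x. l' u = Some x \<Longrightarrow> x \<in> hop_ball G' (k * s) u"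
    and D: "3 * k * (s + 1) \<le> D"
    and agree: "agree D G G' v"
    and l: "\<And>u. u \<in> hop_ball G D v \<Longrightarrow> l u = l' u"
  shows "cstep (hop_ball G k) (verts G) b i l v = cstep (hop_ball G' k) (verts G') b i l' v"
proof -
  have l': "l' u = l u" if "u \<in> hop_ball G' D v" for u
    using l that agree_hop_ball[OF agree, of D] by simp
  have "k \<le> D" using D by (simp add: algebra_simps)
  then have off: "offers (hop_ball G k) i l v = offers (hop_ball G' k) i l' v"
    by (intro offers_local[where l = l and l' = l', OF ok v near(1) D agree l, where r = 0]) simp_all
  have red: "red i l v = red i l' v" using l by (simp add: red_def)
  have eq: "members (verts G) l x = members (verts G') l' x"
      "proposers (hop_ball G k) (verts G) i l x = proposers (hop_ball G' k) (verts G') i l' x"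
    if x: "x \<in> offers (hop_ball G k) i l v" for x
  proof -
    from x obtain u where "u \<in> hop_ball G k v" "l u = Some x" by (auto simp: offers_def)
    then have near_x: "x \<in> hop_ball G (k + k * s) v" using near(1) hop_ball_trans by blast
    have "k + k * s \<le> D" using D by (simp add: algebra_simps)
    then have near_x': "x \<in> hop_ball G' (k + k * s) v" using near_x agree_hop_ball[OF agree, of "k + k * s"] by auto
    show "members (verts G) l x = members (verts G') l' x"
      using members_local[where l = l and l' = l', OF ok v near(1) D agree l near_x]
        members_local[where l = l' and l' = l, OF ok(2,1) v(2,1) near(2) D agree_sym[OF agree] l' near_x'] by blast
    show "proposers (hop_ball G k) (verts G) i l x = proposers (hop_ball G' k) (verts G') i l' x"
      using proposers_local[where l = l and l' = l', OF ok v near(1) D agree l near_x]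
        proposers_local[where l = l' and l' = l, OF ok(2,1) v(2,1) near(2) D agree_sym[OF agree] l' near_x'] by blast
  qed
  show ?thesis
  proof (cases "red i l v \<and> offers (hop_ball G k) i l v \<noteq> {}")
    case True
    then show ?thesis
      using eq[OF Least_offer] off red unfolding cstep_def by simp
  next
    case False
    then show ?thesis using off red l unfolding cstep_def by auto
  qed
qed

text \<open>\<open>D\<close> bounds the cost of each of the first \<open>M\<close> steps, so
  \<open>s\<close> steps together look at most \<open>s * D\<close> hops far.\<close>

lemma clustering_local:
  assumes ok: "network_ok c G" "network_ok c G'"
    and D: "D = 3 * k * (M + 1)"
  shows "s \<le> M \<Longrightarrow> v \<in> verts G \<Longrightarrow> v \<in> verts G' \<Longrightarrow> agree (s * D) G G' v \<Longrightarrow>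
    (\<And>u. u \<in> hop_ball G (s * D) v \<Longrightarrow> u \<in> S \<longleftrightarrow> u \<in> S') \<Longrightarrow>
    clustering (hop_ball G k) (verts G) b T S s v = clustering (hop_ball G' k) (verts G') b T S' s v"
proof (induction s arbitrary: v)
  case (Suc s)
  show ?case
    unfolding clustering.simps
  proof (rule cstep_local[OF ok Suc.prems(2,3), of _ k s _ D])
    show "3 * k * (s + 1) \<le> D" using Suc.prems(1) unfolding D by (intro mult_le_mono2) simp
    show "agree D G G' v" using agree_mono[OF Suc.prems(4)] by simp
    fix u assume u: "u \<in> hop_ball G D v"
    show "clustering (hop_ball G k) (verts G) b T S s u = clustering (hop_ball G' k) (verts G') b T S' s u"
    proof (rule Suc.IH)
      show "s \<le> M" using Suc.prems(1) by simp
      show "u \<in> verts G" using u hop_ball_subset_verts[OF ok(1) Suc.prems(2)] by blast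
      have "hop_ball G D v = hop_ball G' D v" using agree_hop_ball[OF Suc.prems(4), of D] by simp
      then show "u \<in> verts G'" using u hop_ball_subset_verts[OF ok(2) Suc.prems(3)] by blast
      show "agree (s * D) G G' u" using agree_shift[OF Suc.prems(4) u] by simp
      show "w \<in> S \<longleftrightarrow> w \<in> S'" if "w \<in> hop_ball G (s * D) u" for w
        using Suc.prems(5) hop_ball_trans[OF u that] by simp
    qed
  qed (use clustering_label_near in blast)+
qed simp

section \<open>Iterated clustering: colors, labels and a processing order\<close>

primrec rest :: "nat \<Rightarrow> nat \<Rightarrow> nat \<Rightarrow> network \<Rightarrow> nat \<Rightarrow> nat set" where
  "rest k b T G 0 = verts G"
| "rest k b T G (Suc j) = rest k b T G j -
     dom (clustering (hop_ball G k) (verts G) b T (rest k b T G j) (b * T))"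

definition color :: "nat \<Rightarrow> nat \<Rightarrow> nat \<Rightarrow> network \<Rightarrow> nat \<Rightarrow> nat" where
  "color k b T G v = (LEAST j. v \<notin> rest k b T G (Suc j))"

definition label :: "nat \<Rightarrow> nat \<Rightarrow> nat \<Rightarrow> network \<Rightarrow> nat \<Rightarrow> nat" where
  "label k b T G v = the (clustering (hop_ball G k) (verts G) b T
     (rest k b T G (color k b T G v)) (b * T) v)"

text \<open>\<open>b\<close> bits separate all identifiers, \<open>T\<close> makes every blue
  cluster quiet by the end of its phase, and \<open>J\<close> bounds the number of colors.\<close>

locale decomposition =
  fixes c k b T J :: nat and G :: network
  assumes ok: "network_ok c G"
    and ids: "verts G \<subseteq> {..<2 ^ b}" and b: "b > 0"
    and T: "size_of G * (2 * b) ^ T < (2 * b + 1) ^ T"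
    and J: "size_of G < 2 ^ J"
begin

lemma rest_subset: "rest k b T G j \<subseteq> verts G"
  by (induction j) auto

lemmas half = clustering_half[where N = "hop_ball G k", OF finite_verts[OF ok]
    hop_ball_subset_verts[OF ok] hop_ball_sym rest_subset T b]

text \<open>Each round at least halves the rest, and \<open>J\<close> halvings bring fewer than
  \<open>2 ^ J\<close> nodes down to none.\<close>

lemma rest_J: "rest k b T G J = {}"
proof -
  have "card (rest k b T G j) * 2 ^ j \<le> size_of G" for j
  proof (induction j)
    case (Suc j)
    let ?d = "dom (clustering (hop_ball G k) (verts G) b T (rest k b T G j) (b * T))"
    have fin: "finite (rest k b T G j)" using rest_subset finite_verts[OF ok] finite_subset by blast
    have "card (rest k b T G (Suc j)) = card (rest k b T G j) - card ?d"
      using card_Diff_subset[OF finite_subset[OF dom_clustering fin] dom_clustering] by simp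
    then have "2 * card (rest k b T G (Suc j)) \<le> card (rest k b T G j)"
      using half(2)[of j] by simp
    then have "card (rest k b T G (Suc j)) * 2 ^ Suc j \<le> card (rest k b T G j) * 2 ^ j" by simp
    then show ?case using Suc by (rule le_trans)
  qed simp
  from this[of J] J have "card (rest k b T G J) = 0"
    by (metis le_neq_implies_less less_one linorder_not_less mult.commute mult_le_mono2 nat_le_linear nat_mult_1_right order.strict_trans2)
  then show ?thesis using rest_subset finite_verts[OF ok] finite_subset by fastforce
qed

lemma color:
  assumes "v \<in> verts G"
  shows "color k b T G v < J" "v \<in> rest k b T G (color k b T G v)"
    "v \<notin> rest k b T G (Suc (color k b T G v))"
    "clustering (hop_ball G k) (verts G) b T (rest k b T G (color k b T G v)) (b * T) v
       = Some (label k b T G v)"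
proof -
  obtain j where j: "J = Suc j" using rest_J assms by (cases J) auto
  then have "v \<notin> rest k b T G (Suc j)" using rest_J by (metis empty_iff)
  then have least: "color k b T G v \<le> j" "v \<notin> rest k b T G (Suc (color k b T G v))"
    unfolding color_def by (rule Least_le, rule LeastI)
  show "color k b T G v < J" using least j by simp
  show "v \<notin> rest k b T G (Suc (color k b T G v))" by (rule least)
  show in_rest: "v \<in> rest k b T G (color k b T G v)"
  proof (cases "color k b T G v")
    case (Suc m)
    then have "m < (LEAST j. v \<notin> rest k b T G (Suc j))" by (simp add: color_def)
    from not_less_Least[OF this] show ?thesis unfolding Suc by blast
  qed (use assms in simp)
  then show "clustering (hop_ball G k) (verts G) b T (rest k b T G (color k b T G v)) (b * T) v
       = Some (label k b T G v)"
    using least(2) by (auto simp: label_def)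
qed

lemma label_near: "v \<in> verts G \<Longrightarrow> label k b T G v \<in> hop_ball G (k * (b * T)) v"
  using clustering_label_near color(4) by blast

lemma same_cluster_near:
  assumes "u \<in> verts G" "v \<in> verts G" "label k b T G u = label k b T G v"
  shows "u \<in> hop_ball G (2 * (k * (b * T))) v"
  using hop_ball_trans[OF label_near[OF assms(2)] hop_ball_sym[OF label_near[OF assms(1), unfolded assms(3)]]]
  by (simp add: mult_2)

text \<open>Both nodes survive the same clustering, so their labels agree on the lower
  \<open>b\<close> bits. Labels are identifiers, hence below \<open>2 ^ b\<close> and determined by
  these bits.\<close>

lemma same_color_same_label:
  assumes "v \<in> verts G" "u \<in> hop_ball G k v" "color k b T G u = color k b T G v"
  shows "label k b T G u = label k b T G v"
proof -
  have u: "u \<in> verts G" using assms hop_ball_subset_verts[OF ok] by blast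
  have lt: "label k b T G w < 2 ^ b" if "w \<in> verts G" for w
    using label_near[OF that] hop_ball_subset_verts[OF ok that] ids by blast
  have "bit (label k b T G v) j = bit (label k b T G u) j" if "j < b" for j
    using half(1)[of "color k b T G v"] assms(1,2) color(4)[OF assms(1)]
      color(4)[OF u, unfolded assms(3)] that
    unfolding bits_agree_def by blast
  then have "take_bit b (label k b T G v) = take_bit b (label k b T G u)"
    by (intro bit_eqI) (auto simp: bit_take_bit_iff)
  then show ?thesis using lt u assms(1) by (simp add: take_bit_nat_eq_self)
qed

text \<open>The lexicographic order by color, then identifier, because identifiers are below
  \<open>2 ^ b\<close>.\<close>

definition key :: "nat \<Rightarrow> nat" where
  "key v = color k b T G v * 2 ^ b + v"

lemma inj_on_key: "inj_on key (verts G)"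
proof (rule inj_onI)
  fix u v assume *: "u \<in> verts G" "v \<in> verts G" "key u = key v"
  then have "u < 2 ^ b" "v < 2 ^ b" using ids by auto
  then have "key u mod 2 ^ b = u" "key v mod 2 ^ b = v" by (simp_all add: key_def)
  then show "u = v" using *(3) by metis
qed

lemma key_less:
  assumes "u \<in> verts G" "v \<in> verts G" "key u < key v"
  shows "color k b T G u \<le> color k b T G v"
proof (rule ccontr)
  assume "\<not> ?thesis"
  then have "Suc (color k b T G v) * 2 ^ b \<le> color k b T G u * 2 ^ b"
    by (intro mult_le_mono1) simp
  moreover have "v < 2 ^ b" using assms ids by auto
  ultimately show False using assms(3) unfolding key_def mult_Suc by linarith
qed

definition order :: "nat list" where
  "order = sort_key key (sorted_list_of_set (verts G))"

lemma order: "distinct order" "set order = verts G" "sorted (map key order)"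
  using finite_verts[OF ok] by (simp_all add: order_def)

end

section \<open>SLOCAL runs along a sorted order, and what a view depends on\<close>

lemma slocal_run_snoc:
  "slocal_run A r G (xs @ [v]) = (slocal_run A r G xs)(v \<mapsto> s_process A (view_of G r (slocal_run A r G xs) v))"
  by (simp add: slocal_run_def)

lemma slocal_run_append: "u \<notin> set ys \<Longrightarrow> slocal_run A r G (xs @ ys) u = slocal_run A r G xs u"
proof (induction ys rule: rev_induct)
  case (snoc y ys)
  then show ?case using slocal_run_snoc[of A r G "xs @ ys" y] by simp
qed simp

lemma dom_slocal_run: "dom (slocal_run A r G xs) = set xs"
proof (induction xs rule: rev_induct)
  case (snoc x xs)
  then show ?case unfolding slocal_run_snoc dom_fun_upd by simp
qed (simp add: slocal_run_def)

text \<open>Memories are never overwritten, so what \<open>v\<close> saw is the final run restricted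
  to its predecessors. This turns the run into a recursion on \<open>f\<close>.\<close>

lemma slocal_run_sorted:
  fixes f :: "nat \<Rightarrow> nat"
  assumes xs: "distinct xs" "sorted (map f xs)" "inj_on f (set xs)" and v: "v \<in> set xs"
  shows "slocal_run A r G xs v = Some (s_process A (view_of G r
    (\<lambda>u. if u \<in> set xs \<and> f u < f v then slocal_run A r G xs u else None) v))"
proof -
  obtain ys zs where xs_eq: "xs = ys @ v # zs" using v split_list by metis
  have "slocal_run A r G xs v = slocal_run A r G (ys @ [v]) v"
    using xs(1) slocal_run_append[of v zs A r G "ys @ [v]"] by (simp add: xs_eq)
  moreover have "slocal_run A r G ys =
    (\<lambda>u. if u \<in> set xs \<and> f u < f v then slocal_run A r G xs u else None)"
  proof
    fix u
    have "u \<in> set ys" if "u \<in> set xs" "f u < f v"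
      using that xs(2) by (auto simp: xs_eq sorted_append)
    moreover have "u \<in> set xs" "f u < f v" "slocal_run A r G xs u = slocal_run A r G ys u" if "u \<in> set ys"
    proof -
      have "f u \<le> f v" "u \<noteq> v" "u \<notin> set (v # zs)"
        using that xs by (auto simp: xs_eq sorted_append)
      then show "u \<in> set xs" "f u < f v" using that xs(3) by (auto simp: xs_eq le_less inj_on_eq_iff)
      show "slocal_run A r G xs u = slocal_run A r G ys u"
        unfolding xs_eq by (rule slocal_run_append) fact
    qed
    moreover have "slocal_run A r G ys u = None" if "u \<notin> set ys"
      using that dom_slocal_run by blast
    ultimately show "slocal_run A r G ys u =
      (if u \<in> set xs \<and> f u < f v then slocal_run A r G xs u else None)" by auto
  qed
  ultimately show ?thesis by (simp add: slocal_run_snoc)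
qed

lemma view_of_cong:
  assumes ok: "network_ok c G" "network_ok c G'"
    and agree: "agree k G G' v"
    and mem: "\<And>u. u \<in> hop_ball G k v \<Longrightarrow> mem u = mem' u"
  shows "view_of G k mem v = view_of G' k mem' v"
proof -
  have ball: "hop_ball G k v = hop_ball G' k v" using agree_hop_ball[OF agree, of k] by simp
  have edges: "edges H1 \<inter> {e. e \<subseteq> hop_ball G k v} \<subseteq> edges H2"
    if H1: "network_ok c H1" and N: "\<And>u. u \<in> hop_ball G k v \<Longrightarrow> neighbors H1 u = neighbors H2 u" for H1 H2
  proof
    fix e assume e: "e \<in> edges H1 \<inter> {e. e \<subseteq> hop_ball G k v}"
    then obtain u w where uw: "e = {u, w}" using H1 by (auto simp: network_ok_def)
    then have "w \<in> neighbors H1 u" "u \<in> hop_ball G k v" using e by (auto simp: neighbors_def)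
    then show "e \<in> edges H2" using N uw by (auto simp: neighbors_def)
  qed
  have "{e \<in> edges G. e \<subseteq> hop_ball G k v} = {e \<in> edges G'. e \<subseteq> hop_ball G k v}"
    using edges[OF ok(1), of G'] edges[OF ok(2), of G] agree by (auto simp: agree_def)
  moreover have "size_of G = size_of G'" using agree by (simp add: agree_def)
  moreover have "(Some \<circ> inp G) |` hop_ball G k v = (Some \<circ> inp G') |` hop_ball G k v"
    using agree by (auto simp: agree_def restrict_map_def)
  moreover have "mem |` hop_ball G k v = mem' |` hop_ball G k v"
    using mem by (auto simp: restrict_map_def)
  ultimately show ?thesis by (simp add: view_of_def ball)
qed

section \<open>Locality of the decomposition and of the simulated run\<close>

locale two_decompositions = G: decomposition c k b T J G + G': decomposition c k b T J G'
  for c k b T J :: nat and G G' :: network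
begin

abbreviation "M \<equiv> b * T"
abbreviation "E \<equiv> M * (3 * k * (M + 1))"

lemma agree_verts:
  assumes "v \<in> verts G" "v \<in> verts G'" "agree r G G' v" "u \<in> hop_ball G r v"
  shows "u \<in> verts G" "u \<in> verts G'"
  using assms(4) agree_hop_ball[OF assms(3), of r] hop_ball_subset_verts[OF G.ok assms(1), of r]
    hop_ball_subset_verts[OF G'.ok assms(2), of r] by auto

text \<open>A further color costs the \<open>E\<close> hops of one full clustering, on top of the
  radius that decides which nodes take part in it.\<close>

lemma clustering_rest_local:
  assumes "v \<in> verts G" "v \<in> verts G'" "agree (Suc j * E) G G' v"
    and rest: "\<And>u. u \<in> verts G \<Longrightarrow> u \<in> verts G' \<Longrightarrow> agree (j * E) G G' u \<Longrightarrow>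
      u \<in> rest k b T G j \<longleftrightarrow> u \<in> rest k b T G' j"
  shows "clustering (hop_ball G k) (verts G) b T (rest k b T G j) M v =
    clustering (hop_ball G' k) (verts G') b T (rest k b T G' j) M v"
proof (rule clustering_local[OF G.ok G'.ok refl le_refl assms(1,2)])
  show "agree E G G' v" using agree_mono[OF assms(3)] by simp
  fix u assume u: "u \<in> hop_ball G E v"
  then have "agree (j * E) G G' u" using agree_shift[OF assms(3)] by simp
  then show "u \<in> rest k b T G j \<longleftrightarrow> u \<in> rest k b T G' j"
    using rest agree_verts[OF assms(1,2) \<open>agree E G G' v\<close> u] by blast
qed

lemma rest_local:
  "v \<in> verts G \<Longrightarrow> v \<in> verts G' \<Longrightarrow> agree (j * E) G G' v \<Longrightarrow>
    v \<in> rest k b T G j \<longleftrightarrow> v \<in> rest k b T G' j"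
proof (induction j arbitrary: v)
  case (Suc j)
  have "agree (j * E) G G' v" using agree_mono[OF Suc.prems(3)] by simp
  then show ?case
    using Suc.IH[OF Suc.prems(1,2)] clustering_rest_local[OF Suc.prems Suc.IH] by (simp add: dom_def)
qed simp

lemma color_label_local:
  assumes v: "v \<in> verts G" "v \<in> verts G'" and agree: "agree (J * E) G G' v"
  shows "color k b T G v = color k b T G' v" "label k b T G v = label k b T G' v"
proof -
  have rest: "v \<in> rest k b T G j \<longleftrightarrow> v \<in> rest k b T G' j" if "j \<le> J" for j
    by (rule rest_local[OF v agree_mono[OF agree]]) (use that in simp)
  have "color k b T G v \<le> color k b T G' v"
    using rest[of "Suc (color k b T G' v)"] G'.color(1,3)[OF v(2)]
    unfolding color_def[of k b T G v] by (intro Least_le) simp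
  moreover have "color k b T G' v \<le> color k b T G v"
    using rest[of "Suc (color k b T G v)"] G.color(1,3)[OF v(1)]
    unfolding color_def[of k b T G' v] by (intro Least_le) simp
  ultimately show eq: "color k b T G v = color k b T G' v" by simp
  have "Suc (color k b T G v) * E \<le> J * E"
    using G.color(1)[OF v(1)] by (intro mult_le_mono1) simp
  then have "agree (Suc (color k b T G v) * E) G G' v" using agree_mono[OF agree] by blast
  from clustering_rest_local[OF v this rest_local]
  show "label k b T G v = label k b T G' v" by (simp add: label_def eq)
qed

text \<open>
  Nodes of equal color in different clusters do not see each other.  Hence the memory of a node
  only depends on lower colors and on its own cluster, which is why the radius grows with the
  color but not with the position inside the cluster.
\<close>

lemma slocal_run_local:
  assumes "v \<in> verts G" "v \<in> verts G'"
    and "\<And>u. u \<in> verts G \<Longrightarrow> color k b T G u = color k b T G v \<Longrightarrow>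
      label k b T G u = label k b T G v \<Longrightarrow>
      agree (J * E + color k b T G v * (2 * (k * M) + k) + k) G G' u \<and> u \<in> verts G'"
  shows "slocal_run A k G G.order v = slocal_run A k G' G'.order v"
  using assms
proof (induction "G.key v" arbitrary: v rule: less_induct)
  case less
  let ?j = "color k b T G v"
  \<comment> \<open>The diameter bound of a cluster plus one view: the price of passing to a lower
    color.\<close>
  let ?Q = "2 * (k * M) + k"
  have v: "agree (J * E + ?j * ?Q + k) G G' v" using less.prems by blast
  then have vk: "agree k G G' v" by (rule agree_mono) simp
  have near: "agree (J * E + ?j * ?Q) G G' u" "u \<in> verts G" "u \<in> verts G'" "G.key u = G'.key u"
    if u: "u \<in> hop_ball G k v" for u
  proof -
    show *: "agree (J * E + ?j * ?Q) G G' u" using agree_shift[OF v u] by simp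
    show V: "u \<in> verts G" "u \<in> verts G'" using agree_verts[OF less.prems(1,2) vk u] .
    show "G.key u = G'.key u"
      using color_label_local(1)[OF V agree_mono[OF *]] by (simp add: G.key_def G'.key_def)
  qed
  have IH: "slocal_run A k G G.order u = slocal_run A k G' G'.order u"
    if u: "u \<in> hop_ball G k v" and lt: "G.key u < G.key v" for u
  proof (rule less.hyps[OF lt near(2,3)[OF u]])
    fix w assume w: "w \<in> verts G" "color k b T G w = color k b T G u" "label k b T G w = label k b T G u"
    have le: "color k b T G u \<le> ?j" by (rule G.key_less[OF near(2)[OF u] less.prems(1) lt])
    show "agree (J * E + color k b T G u * ?Q + k) G G' w \<and> w \<in> verts G'"
    \<comment> \<open>At equal color \<open>u\<close> belongs to the cluster of \<open>v\<close>,
      and the assumption on that cluster is handed on without loss. At lower color a full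
      \<open>?Q\<close> is released, which pays for crossing the cluster of
      \<open>u\<close>.\<close>
    proof (cases "color k b T G u = ?j")
      case True
      then show ?thesis
        using less.prems(3)[OF w(1)] w(2,3) G.same_color_same_label[OF less.prems(1) u] by simp
    next
      case False
      then have "Suc (color k b T G u) * ?Q \<le> ?j * ?Q" using le by (intro mult_le_mono1) simp
      then have le: "J * E + color k b T G u * ?Q + k + 2 * (k * M) \<le> J * E + ?j * ?Q" by simp
      have wu: "w \<in> hop_ball G (2 * (k * M)) u"
        by (rule G.same_cluster_near[OF w(1) near(2)[OF u] w(3)])
      have "2 * (k * M) \<le> J * E + ?j * ?Q" using le by simp
      then have "w \<in> verts G'"
        using agree_verts(2)[OF near(2,3)[OF u] agree_mono[OF near(1)[OF u]] wu] by simp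
      then show ?thesis using agree_shift[OF near(1)[OF u] wu le] by simp
    qed
  qed
  have run: "slocal_run A k H xs v = Some (s_process A (view_of H k
      (\<lambda>u. if u \<in> verts H \<and> f u < f v then slocal_run A k H xs u else None) v))"
    if "distinct xs" "set xs = verts H" "sorted (map f xs)" "inj_on f (verts H)" "v \<in> verts H"
    for H xs and f :: "nat \<Rightarrow> nat"
    using slocal_run_sorted[of xs f v A k H] that by simp
  have "view_of G k (\<lambda>u. if u \<in> verts G \<and> G.key u < G.key v then slocal_run A k G G.order u else None) v =
    view_of G' k (\<lambda>u. if u \<in> verts G' \<and> G'.key u < G'.key v then slocal_run A k G' G'.order u else None) v"
    using near IH near(4)[of v] by (intro view_of_cong[OF G.ok G'.ok vk]) auto
  then show ?case
    using run[OF G.order G.inj_on_key less.prems(1)] run[OF G'.order G'.inj_on_key less.prems(2)]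
    by simp
qed

text \<open>The summands of the radius pay for colors and labels, for the descent through at most
  \<open>J\<close> colors, for one view, and for reaching the whole cluster of
  \<open>v\<close>.\<close>

lemma slocal_output_local:
  assumes v: "v \<in> verts G" "v \<in> verts G'"
    and agree: "agree (J * E + J * (2 * (k * M) + k) + k + 2 * (k * M)) G G' v"
  shows "slocal_output A k G G.order v = slocal_output A k G' G'.order v"
proof -
  have "slocal_run A k G G.order v = slocal_run A k G' G'.order v"
  proof (rule slocal_run_local[OF v])
    fix u assume u: "u \<in> verts G" "color k b T G u = color k b T G v" "label k b T G u = label k b T G v"
    have near: "u \<in> hop_ball G (2 * (k * M)) v" by (rule G.same_cluster_near[OF u(1) v(1) u(3)])
    have "color k b T G v * (2 * (k * M) + k) \<le> J * (2 * (k * M) + k)"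
      using G.color(1)[OF v(1)] by (intro mult_le_mono1) simp
    moreover have "u \<in> verts G'"
      using agree_verts(2)[OF v agree_mono[OF agree] near] by simp
    ultimately show "agree (J * E + color k b T G v * (2 * (k * M) + k) + k) G G' u \<and> u \<in> verts G'"
      using agree_shift[OF agree near] by simp
  qed
  then show ?thesis using v by (simp add: slocal_output_def)
qed

end

section \<open>Deterministic LOCAL simulates SLOCAL\<close>

text \<open>Identifiers are at most n^c \<le> 2^(c lg n); one more bit makes this bound strict and
  the number of bits positive.\<close>

definition id_bits :: "nat \<Rightarrow> nat \<Rightarrow> nat" where
  "id_bits c n = c * lg n + 1"

text \<open>With b = \<open>id_bits c n\<close>, the growth factor 1 + 1 / 2b at least doubles over
  2b steps, and \<open>lg n + 1\<close> doublings exceed \<open>n\<close>.\<close>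

definition phase_length :: "nat \<Rightarrow> nat \<Rightarrow> nat" where
  "phase_length c n = 2 * id_bits c n * (lg n + 1)"

text \<open>Bernoulli's inequality gives (1 + 1 / m)^m \<ge> 2; the statement is this with
  denominators cleared.\<close>

lemma two_times_self_power_le:
  assumes "m > 0"
  shows "2 * m ^ m \<le> (m + 1) ^ m"
proof -
  have "1 + real m * (1 / real m) \<le> (1 + 1 / real m) ^ m"
    by (rule Bernoulli_inequality) (rule order_trans[of _ 0], simp_all)
  then have "2 \<le> (1 + 1 / real m) ^ m" using assms by simp
  then have "2 * real m ^ m \<le> (1 + 1 / real m) ^ m * real m ^ m"
    by (intro mult_right_mono) simp_all
  also have "\<dots> = ((1 + 1 / real m) * real m) ^ m" by (simp add: power_mult_distrib)
  also have "(1 + 1 / real m) * real m = real (m + 1)" using assms by (simp add: field_simps)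
  finally have "real (2 * m ^ m) \<le> real ((m + 1) ^ m)" by simp
  then show ?thesis by (simp only: of_nat_le_iff)
qed

lemma decomposition_parameters:
  assumes ok: "network_ok c G"
  shows "decomposition c (id_bits c (size_of G)) (phase_length c (size_of G)) (lg (size_of G) + 1) G"
proof
  let ?n = "size_of G"
  let ?b = "id_bits c ?n"
  show "network_ok c G" by fact
  show "?b > 0" by (simp add: id_bits_def)
  have n: "?n < 2 ^ (lg ?n + 1)"
    by (rule le_less_trans[OF le_two_power_lg]) simp
  then show "?n < 2 ^ (lg ?n + 1)" .
  have "?n ^ c \<le> (2 ^ lg ?n) ^ c" by (intro power_mono le_two_power_lg) simp
  also have "\<dots> < 2 ^ ?b" by (simp add: id_bits_def power_mult[symmetric] mult.commute)
  finally show "verts G \<subseteq> {..<2 ^ ?b}" using ok by (fastforce simp: network_ok_def)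
  have "2 * (2 * ?b) ^ (2 * ?b) \<le> (2 * ?b + 1) ^ (2 * ?b)"
    by (rule two_times_self_power_le) (use \<open>?b > 0\<close> in simp)
  then have "(2 * (2 * ?b) ^ (2 * ?b)) ^ (lg ?n + 1) \<le> ((2 * ?b + 1) ^ (2 * ?b)) ^ (lg ?n + 1)"
    by (intro power_mono) simp_all
  then have "2 ^ (lg ?n + 1) * (2 * ?b) ^ phase_length c ?n \<le> (2 * ?b + 1) ^ phase_length c ?n"
    unfolding phase_length_def power_mult power_mult_distrib .
  moreover have "?n * (2 * ?b) ^ phase_length c ?n < 2 ^ (lg ?n + 1) * (2 * ?b) ^ phase_length c ?n"
    using n \<open>?b > 0\<close> by (intro mult_strict_right_mono) simp_all
  ultimately show "?n * (2 * ?b) ^ phase_length c ?n < (2 * ?b + 1) ^ phase_length c ?n" by linarith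
qed

theorem P_SLOCAL_subset_P_LOCAL: "P_SLOCAL \<subseteq> P_LOCAL"
  unfolding P_LOCAL_def
proof (intro subsetI CollectI allI)
  fix Q c
  assume "Q \<in> P_SLOCAL"
  then obtain A R where R: "polylog (\<lambda>n. real (R n))" and A: "slocal_solves c A R Q"
    unfolding P_SLOCAL_def by blast
  define r where "r = (\<lambda>n. let k = R n; M = id_bits c n * phase_length c n; J = lg n + 1 in
    J * (M * (3 * k * (M + 1))) + J * (2 * (k * M) + k) + k + 2 * (k * M))"
  \<comment> \<open>\<open>A\<close> is correct for every order, so it may be run along this one.
    The order is a function of the network alone, so all nodes simulate the same run.\<close>
  define ord where "ord = (\<lambda>G. decomposition.order (R (size_of G)) (id_bits c (size_of G))
    (phase_length c (size_of G)) G)"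
  define f where "f = (\<lambda>G. slocal_output A (R (size_of G)) G (ord G))"
  have "local_fun c r f"
    unfolding local_fun_def
  proof (intro allI impI, elim conjE)
    fix G G' v
    assume ok: "network_ok c G" "network_ok c G'" and v: "v \<in> verts G" "v \<in> verts G'"
      and agree: "agree (r (size_of G)) G G' v"
    have size: "size_of G' = size_of G" using agree by (simp add: agree_def)
    interpret two_decompositions c "R (size_of G)" "id_bits c (size_of G)"
      "phase_length c (size_of G)" "lg (size_of G) + 1" G G'
      using decomposition_parameters[OF ok(1)] decomposition_parameters[OF ok(2)] unfolding size two_decompositions_def by blast
    show "f G v = f G' v"
      using slocal_output_local[OF v, of A] agree unfolding f_def ord_def size r_def Let_def by blast
  qed
  then obtain B where B: "\<And>G v. network_ok c G \<Longrightarrow> v \<in> verts G \<Longrightarrow>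
      l_out B (local_state B G (Suc (r (size_of G))) v) = f G v"
    by (rule local_fun_realizable) blast
  \<comment> \<open>The additional round is the one by which gathering exceeds the radius of
    agreement.\<close>
  have "local_solves c B (\<lambda>n. Suc (r n)) Q"
    unfolding local_solves_def
  proof (intro allI impI, elim conjE)
    fix G
    assume G: "network_ok c G" "admissible Q G"
    interpret decomposition c "R (size_of G)" "id_bits c (size_of G)"
      "phase_length c (size_of G)" "lg (size_of G) + 1" G
      by (rule decomposition_parameters[OF G(1)])
    have "local_output B (Suc (r (size_of G))) G = f G"
      using B[OF G(1)] by (auto simp: local_output_def f_def slocal_output_def simp del: local_state.simps)
    moreover have "solution Q G (f G)"
      using A G order unfolding slocal_solves_def f_def ord_def by blast
    ultimately show "solution Q G (local_output B (Suc (r (size_of G))) G)" by simp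
  qed
  moreover have "polylog (\<lambda>n. real (Suc (r n)))"
    unfolding r_def Let_def id_bits_def phase_length_def of_nat_Suc of_nat_add of_nat_mult
    by (intro polylog_add polylog_mult polylog_const polylog_lg R)
  ultimately show "\<exists>A T. polylog (\<lambda>n. real (T n)) \<and> local_solves c A T Q" by (intro exI conjI)
qed

section \<open>Approximating set cover by ball growing\<close>

text \<open>Peels off the last hop instead of the first, as needed when the center stays fixed and
  the radius grows.\<close>

lemma hop_ball_Suc_right:
  "hop_ball G (Suc r) v = insert v (\<Union>u\<in>hop_ball G r v. neighbors G u)"
proof (intro equalityI subsetI)
  fix w assume "w \<in> hop_ball G (Suc r) v"
  then have "v \<in> hop_ball G (Suc r) w" by (rule hop_ball_sym)
  then have "v = w \<or> (\<exists>u. u \<in> neighbors G w \<and> v \<in> hop_ball G r u)" by (auto simp: hop_ball_Suc)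
  then have "v = w \<or> (\<exists>u. w \<in> neighbors G u \<and> u \<in> hop_ball G r v)"
    by (metis neighbors_sym hop_ball_sym)
  then show "w \<in> insert v (\<Union>u\<in>hop_ball G r v. neighbors G u)" by blast
next
  fix w assume "w \<in> insert v (\<Union>u\<in>hop_ball G r v. neighbors G u)"
  then consider "w = v" | u where "u \<in> hop_ball G r v" "w \<in> neighbors G u" by blast
  then show "w \<in> hop_ball G (Suc r) v"
  proof cases
    case 2
    then have "w \<in> hop_ball G (r + Suc 0) v" using hop_ball_trans neighbors_hop_ball by blast
    then show ?thesis by simp
  qed simp
qed

text \<open>A view contains only the edges inside its ball, so neighborhoods are guaranteed complete
  only one hop before the boundary. This hop is the \<open>Suc\<close> in the locality.\<close>

lemma view_of_determines_ball:
  assumes eq: "view_of G (Suc r) mem v = view_of G' (Suc r) mem' v"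
  shows "agree r G G' v \<and> (\<forall>u\<in>hop_ball G r v. mem u = mem' u)"
proof -
  define B where "B = hop_ball G (Suc r) v"
  have B: "hop_ball G' (Suc r) v = B" and n: "size_of G = size_of G'"
    and edges: "{e \<in> edges G. e \<subseteq> B} = {e \<in> edges G'. e \<subseteq> B}"
    and inp: "(Some \<circ> inp G) |` B = (Some \<circ> inp G') |` B" and mem: "mem |` B = mem' |` B"
    using eq by (auto simp: view_of_def B_def)
  have N: "neighbors H u \<subseteq> neighbors H' u"
    if "u \<in> hop_ball H r v" "hop_ball H (Suc r) v = B" "{e \<in> edges H. e \<subseteq> B} \<subseteq> edges H'" for H H' u
  proof
    fix w assume w: "w \<in> neighbors H u"
    then have "{u, w} \<subseteq> B" using that(1,2) hop_ball_mono[of r "Suc r" H v] by (auto simp: hop_ball_Suc_right)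
    then show "w \<in> neighbors H' u" using w that(3) by (auto simp: neighbors_def)
  qed
  have sub: "s \<le> Suc r \<Longrightarrow> hop_ball H s v \<subseteq> hop_ball H' s v"
    if "hop_ball H (Suc r) v = B" "{e \<in> edges H. e \<subseteq> B} \<subseteq> edges H'" for H H' s
  proof (induction s)
    case (Suc s)
    then have "hop_ball H s v \<subseteq> hop_ball H r v" by (intro hop_ball_mono) simp
    then show ?case using Suc N[OF _ that] unfolding hop_ball_Suc_right by fastforce
  qed simp
  have e: "{e \<in> edges G. e \<subseteq> B} \<subseteq> edges G'" "{e \<in> edges G'. e \<subseteq> B} \<subseteq> edges G"
    using edges by auto
  have "neighbors G u = neighbors G' u \<and> inp G u = inp G' u \<and> mem u = mem' u"
    if u: "u \<in> hop_ball G r v" for u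
  proof (intro conjI)
    have u': "u \<in> hop_ball G' r v" using sub[OF B_def[symmetric] e(1), of r] u by auto
    show "neighbors G u = neighbors G' u"
      using N[OF u B_def[symmetric] e(1)] N[OF u' B e(2)] by blast
    have "u \<in> B" using u hop_ball_mono[of r "Suc r" G v] by (auto simp: B_def)
    then show "inp G u = inp G' u" "mem u = mem' u"
      using fun_cong[OF inp, of u] fun_cong[OF mem, of u] by simp_all
  qed
  then show ?thesis using n by (simp add: agree_def)
qed

text \<open>As in the LOCAL model, the view is inverted up to indistinguishability by choice.\<close>

lemma slocal_realizable:
  fixes F :: "network \<Rightarrow> (nat \<Rightarrow> nat option) \<Rightarrow> nat \<Rightarrow> nat"
  assumes "\<And>G G' mem mem' v. agree (r (size_of G)) G G' v \<Longrightarrow>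
    (\<And>u. u \<in> hop_ball G (r (size_of G)) v \<Longrightarrow> mem u = mem' u) \<Longrightarrow> F G mem v = F G' mem' v"
  obtains p where "\<And>G mem v. p (view_of G (Suc (r (size_of G))) mem v) = F G mem v"
proof -
  define vw where "vw = (\<lambda>(G, mem, v). view_of G (Suc (r (size_of G))) mem v)"
  define p where "p = (\<lambda>w. case SOME x. vw x = w of (G, mem, v) \<Rightarrow> F G mem v)"
  have "p (view_of G (Suc (r (size_of G))) mem v) = F G mem v" for G mem v
  proof -
    obtain G' mem' v' where G': "(SOME x. vw x = vw (G, mem, v)) = (G', mem', v')"
      using prod_cases3 by blast
    have "vw (G', mem', v') = vw (G, mem, v)"
      using someI[of "\<lambda>x. vw x = vw (G, mem, v)", OF refl] unfolding G' .
    then have eq: "view_of G (Suc (r (size_of G))) mem v = view_of G' (Suc (r (size_of G'))) mem' v'"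
      by (simp add: vw_def)
    then have "v' = v" "size_of G' = size_of G" by (auto simp: view_of_def)
    with eq have "F G mem v = F G' mem' v'"
      using view_of_determines_ball assms by metis
    then show ?thesis using G' by (simp add: p_def vw_def)
  qed
  then show ?thesis by (rule that)
qed

section \<open>Charging covers that are chosen one after another\<close>

text \<open>
  Every center \<open>a\<close> pays for the elements of \<open>cp a\<close> that are not yet captured and charges
  only \<open>I a\<close>.  A set meeting \<open>I a\<close> is captured by \<open>a\<close> as a whole, so the sets of
  a cover are charged at most once.
\<close>

lemma sequential_cover:
  fixes f :: "'a \<Rightarrow> nat" and nb :: "'a \<Rightarrow> 'b set" and \<beta> :: real
  defines "C \<equiv> \<lambda>cp S a. \<Union>b\<in>{b\<in>S. f b < f a}. cp b"
  assumes fin: "finite S" and inj: "inj_on f S"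
    and own: "\<And>a. a \<in> S \<Longrightarrow> nb a \<subseteq> cp a"
    and closed: "\<And>a d. a \<in> S \<Longrightarrow> d \<in> S \<Longrightarrow> nb d \<inter> I a \<noteq> {} \<Longrightarrow> nb d \<subseteq> cp a"
    and disj: "\<And>a. a \<in> S \<Longrightarrow> I a \<inter> C cp S a = {}"
    and ch: "\<And>a. a \<in> S \<Longrightarrow> ch a \<subseteq> S" "\<And>a. a \<in> S \<Longrightarrow> cp a - C cp S a \<subseteq> \<Union>(nb ` ch a)"
    and cost: "\<And>a D. a \<in> S \<Longrightarrow> D \<subseteq> S \<Longrightarrow> I a \<subseteq> \<Union>(nb ` D) \<Longrightarrow> real (card (ch a)) \<le> \<beta> * real (card D)"
    and \<beta>: "\<beta> \<ge> 0"
  defines "W \<equiv> {a\<in>S. \<exists>b\<in>S. f b \<le> f a \<and> a \<in> ch b}"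
  shows "\<Union>(nb ` S) \<subseteq> \<Union>(nb ` W)"
    and "\<And>D. D \<subseteq> S \<Longrightarrow> (\<And>a. a \<in> S \<Longrightarrow> I a \<subseteq> \<Union>(nb ` D)) \<Longrightarrow> real (card W) \<le> \<beta> * real (card D)"
proof -
  show "\<Union>(nb ` S) \<subseteq> \<Union>(nb ` W)"
  proof
    fix x assume "x \<in> \<Union>(nb ` S)"
    then have "\<exists>a. a \<in> S \<and> x \<in> cp a" using own by blast
    \<comment> \<open>Let \<open>a\<close> be the first center that captures \<open>x\<close>. A
      chosen set \<open>d\<close> containing \<open>x\<close> captures its own elements, so it is
      not processed before \<open>a\<close> and can still join the cover when its turn
      comes.\<close>
    then obtain a where a: "a \<in> S" "x \<in> cp a"
      and least: "\<And>b. b \<in> S \<Longrightarrow> x \<in> cp b \<Longrightarrow> f a \<le> f b"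
      using exists_least_iff[of "\<lambda>m. \<exists>a. a \<in> S \<and> x \<in> cp a \<and> f a = m"] by (metis linorder_not_le)
    then have "x \<notin> C cp S a" unfolding C_def by fastforce
    then obtain d where d: "d \<in> ch a" "x \<in> nb d" using ch(2)[OF a(1)] a(2) by blast
    then have "d \<in> S" using ch(1)[OF a(1)] by blast
    moreover from this have "f a \<le> f d" using own d least by blast
    ultimately show "x \<in> \<Union>(nb ` W)" using d a unfolding W_def by blast
  qed
next
  fix D assume D: "D \<subseteq> S" "\<And>a. a \<in> S \<Longrightarrow> I a \<subseteq> \<Union>(nb ` D)"
  define D' where "D' = (\<lambda>a. {d\<in>D. nb d \<inter> I a \<noteq> {}})"
  have finD: "finite D" using D(1) fin finite_subset by blast
  have no_overlap: "D' a \<inter> D' b = {}" if "a \<in> S" "b \<in> S" "f a < f b" for a b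
  proof -
    have "cp a \<subseteq> C cp S b" using that unfolding C_def by blast
    then show ?thesis using that D(1) closed[of a] disj[of b] unfolding D'_def by blast
  qed
  have "W \<subseteq> (\<Union>a\<in>S. ch a)" unfolding W_def by blast
  moreover have "finite (\<Union>a\<in>S. ch a)" using ch(1) fin finite_subset by blast
  ultimately have "card W \<le> card (\<Union>a\<in>S. ch a)" by (intro card_mono)
  also have "\<dots> \<le> (\<Sum>a\<in>S. card (ch a))" by (rule card_UN_le[OF fin])
  finally have "real (card W) \<le> (\<Sum>a\<in>S. real (card (ch a)))"
    by (metis of_nat_le_iff of_nat_sum)
  also have "\<dots> \<le> (\<Sum>a\<in>S. \<beta> * real (card (D' a)))"
  proof (rule sum_mono)
    fix a assume a: "a \<in> S"
    have "I a \<subseteq> \<Union>(nb ` D' a)" using D(2)[OF a] unfolding D'_def by blast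
    then show "real (card (ch a)) \<le> \<beta> * real (card (D' a))"
      using cost[OF a, of "D' a"] D(1) unfolding D'_def by blast
  qed
  also have "\<dots> = \<beta> * real (card (\<Union>a\<in>S. D' a))"
  proof -
    have "card (\<Union>a\<in>S. D' a) = (\<Sum>a\<in>S. card (D' a))"
    proof (rule card_UN_disjoint[OF fin])
      show "\<forall>a\<in>S. finite (D' a)" using finD by (simp add: D'_def)
      show "\<forall>a\<in>S. \<forall>b\<in>S. a \<noteq> b \<longrightarrow> D' a \<inter> D' b = {}"
        using no_overlap inj by (metis Int_commute inj_onD linorder_less_linear)
    qed
    then show ?thesis by (simp add: sum_distrib_left)
  qed
  also have "\<dots> \<le> \<beta> * real (card D)"
    using \<beta> finD by (intro mult_left_mono of_nat_mono card_mono) (auto simp: D'_def)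
  finally show "real (card W) \<le> \<beta> * real (card D)" .
qed

text \<open>Otherwise \<open>g\<close> rises at \<open>J + 1\<close> consecutive steps: as an
  integer it then exceeds any n \<le> J, and by its factor it reaches \<beta>^J. Either contradicts
  the bound \<open>n\<close>.\<close>

lemma bounded_growth:
  fixes g :: "nat \<Rightarrow> nat" and \<beta> :: real
  assumes g: "\<And>j. g j \<le> n" and \<beta>: "\<beta> \<ge> 1" and J: "n \<le> J \<or> real n < \<beta> ^ J"
  shows "\<exists>j\<le>J. real (g (Suc j)) \<le> \<beta> * real (g j)"
proof (rule ccontr)
  assume "\<not> ?thesis"
  then have grow: "\<beta> * real (g j) < real (g (Suc j))" if "j \<le> J" for j
    using that by (meson not_le)
  show False
    using J
  proof
    assume "n \<le> J"
    have "j \<le> Suc J \<Longrightarrow> j \<le> g j" for j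
    proof (induction j)
      case (Suc j)
      have "1 * real (g j) \<le> \<beta> * real (g j)" using \<beta> by (intro mult_right_mono) simp_all
      then have "g j < g (Suc j)" using grow[of j] Suc.prems by simp
      then show ?case using Suc by simp
    qed simp
    from this[of "Suc J"] show False using g[of "Suc J"] \<open>n \<le> J\<close> by simp
  next
    assume "real n < \<beta> ^ J"
    \<comment> \<open>The index is shifted because \<open>g 0\<close> may be 0: the first strict
      increase gives \<open>g 1 \<ge> 1\<close>, and the factor takes effect from there.\<close>
    have "j \<le> J \<Longrightarrow> \<beta> ^ j \<le> real (g (Suc j))" for j
    proof (induction j)
      case 0
      have "0 \<le> \<beta> * real (g 0)" using \<beta> by simp
      then show ?case using grow[of 0] by simp
    next
      case (Suc j)
      then have "\<beta> * \<beta> ^ j \<le> \<beta> * real (g (Suc j))" using \<beta> by (intro mult_left_mono) simp_all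
      then show ?case using grow[OF Suc.prems] by simp
    qed
    from this[of J] show False using g[of "Suc J"] \<open>real n < \<beta> ^ J\<close> by linarith
  qed
qed

text \<open>By Bernoulli about \<open>ln n ^ k\<close> steps with excess \<open>1 / ln n ^ k\<close>
  double, and \<open>lg n + 1\<close> doublings exceed \<open>n\<close>.\<close>

lemma growth_depth:
  fixes \<beta> :: "nat \<Rightarrow> real"
  assumes "\<forall>\<^sub>F n in sequentially. \<beta> n \<ge> 1 + 1 / ln (real n) ^ k"
  obtains J where "polylog (\<lambda>n. real (J n))" "\<And>n. n \<le> J n \<or> real n < \<beta> n ^ J n"
proof -
  from assms obtain n0 where n0: "\<And>n. n \<ge> n0 \<Longrightarrow> \<beta> n \<ge> 1 + 1 / ln (real n) ^ k"
    unfolding eventually_sequentially by blast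
  define L where "L = (\<lambda>n::nat. nat \<lceil>ln (real n) ^ k\<rceil>)"
  \<comment> \<open>Below the threshold the first alternative holds with \<open>J n = n\<close>;
    these are finitely many values, so the growth stays polylogarithmic. The 2 makes the logarithm
    positive.\<close>
  define J where "J = (\<lambda>n. if n < max n0 2 then n else L n * (lg n + 1))"
  have large: "real n < \<beta> n ^ J n" if n: "n \<ge> max n0 2" for n
  proof -
    define x where "x = 1 / ln (real n) ^ k"
    have ln: "ln (real n) > 0" using n by (intro ln_gt_zero) simp
    then have x: "x > 0" by (simp add: x_def)
    have "1 = ln (real n) ^ k * x" using ln by (simp add: x_def)
    also have "\<dots> \<le> real (L n) * x"
      unfolding L_def using x by (intro mult_right_mono real_nat_ceiling_ge) simp
    finally have "2 \<le> 1 + real (L n) * x" by simp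
    also have "\<dots> \<le> (1 + x) ^ L n" using x by (intro Bernoulli_inequality) simp
    also have "\<dots> \<le> \<beta> n ^ L n" using x n n0[of n] by (intro power_mono) (auto simp: x_def)
    finally have "2 ^ (lg n + 1) \<le> (\<beta> n ^ L n) ^ (lg n + 1)" by (intro power_mono) simp_all
    also have "\<dots> = \<beta> n ^ J n" unfolding power_mult[symmetric] using n by (auto simp: J_def)
    finally have "2 ^ (lg n + 1) \<le> \<beta> n ^ J n" .
    moreover have "n < 2 ^ (lg n + 1)"
      by (rule le_less_trans[OF le_two_power_lg]) simp
    then have "real n < 2 ^ (lg n + 1)" by (metis of_nat_less_iff of_nat_numeral of_nat_power)
    ultimately show ?thesis by linarith
  qed
  have "n \<le> J n \<or> real n < \<beta> n ^ J n" for n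
  proof (cases "n < max n0 2")
    case True
    then show ?thesis by (simp add: J_def)
  next
    case False
    then show ?thesis using large[of n] by linarith
  qed
  moreover have "polylog (\<lambda>n. real (J n))"
  proof (rule polylog_mono)
    show "polylog (\<lambda>n. (ln (real n) ^ k + 1) * (real (lg n) + 1))"
      by (intro polylog_mult polylog_add polylog_ln_power polylog_const polylog_lg)
    show "\<forall>\<^sub>F n in sequentially. \<bar>real (J n)\<bar> \<le> (ln (real n) ^ k + 1) * (real (lg n) + 1)"
      using eventually_ge_at_top[of "max n0 2"]
    proof eventually_elim
      case (elim n)
      have "0 \<le> ln (real n) ^ k" using elim by simp
      then have "real (L n) \<le> ln (real n) ^ k + 1" by (simp add: L_def)
      then have "real (L n) * (real (lg n) + 1) \<le> (ln (real n) ^ k + 1) * (real (lg n) + 1)"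
        by (intro mult_right_mono) simp_all
      moreover have "J n = L n * (lg n + 1)" using elim by (auto simp: J_def)
      ultimately show ?case unfolding abs_of_nat by (simp only: of_nat_mult of_nat_add of_nat_1)
    qed
  qed
  ultimately show ?thesis using that by blast
qed

section \<open>Ball growing at a single set node\<close>

definition covers :: "('a \<Rightarrow> 'b set) \<Rightarrow> 'a set \<Rightarrow> 'b set \<Rightarrow> 'a set set" where
  "covers nb S Y = {D. D \<subseteq> S \<and> Y \<subseteq> \<Union>(nb ` D)}"

definition cost :: "'a set set \<Rightarrow> nat" where
  "cost \<D> = Min (card ` \<D>)"

text \<open>The choice depends on the family alone, so networks with the same local candidates
  select the same cover.\<close>

definition min_cover :: "'a set set \<Rightarrow> 'a set" where
  "min_cover \<D> = (SOME D. D \<in> \<D> \<and> card D = cost \<D>)"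

lemma
  assumes "finite S" "Y \<subseteq> \<Union>(nb ` S)"
  shows min_cover_in: "min_cover (covers nb S Y) \<in> covers nb S Y"
    and card_min_cover: "card (min_cover (covers nb S Y)) = cost (covers nb S Y)"
    and cost_le: "D \<in> covers nb S Y \<Longrightarrow> cost (covers nb S Y) \<le> card D"
proof -
  have fin: "finite (covers nb S Y)"
    by (rule finite_subset[of _ "Pow S"]) (use assms(1) in \<open>auto simp: covers_def\<close>)
  have "S \<in> covers nb S Y" using assms(2) by (simp add: covers_def)
  then have "cost (covers nb S Y) \<in> card ` covers nb S Y"
    unfolding cost_def using fin by (intro Min_in) auto
  then have "\<exists>D. D \<in> covers nb S Y \<and> card D = cost (covers nb S Y)" by auto
  from someI_ex[OF this] show "min_cover (covers nb S Y) \<in> covers nb S Y"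
    "card (min_cover (covers nb S Y)) = cost (covers nb S Y)"
    unfolding min_cover_def by auto
  show "D \<in> covers nb S Y \<Longrightarrow> cost (covers nb S Y) \<le> card D"
    unfolding cost_def using fin by (intro Min_le) auto
qed

text \<open>Later nodes read the captured elements to compute what is left for them, and the cover
  to learn whether an earlier center has chosen them.\<close>

definition encode_mem :: "bool \<Rightarrow> nat set \<Rightarrow> nat set \<Rightarrow> nat" where
  "encode_mem chosen E D = prod_encode (of_bool chosen, prod_encode (set_encode E, set_encode D))"

definition mem_out :: "nat \<Rightarrow> nat" where
  "mem_out m = fst (prod_decode m)"

definition mem_captured :: "nat \<Rightarrow> nat set" where
  "mem_captured m = set_decode (fst (prod_decode (snd (prod_decode m))))"

definition mem_cover :: "nat \<Rightarrow> nat set" where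
  "mem_cover m = set_decode (snd (prod_decode (snd (prod_decode m))))"

lemma encode_mem [simp]:
  "mem_out (encode_mem s E D) = of_bool s"
  "finite E \<Longrightarrow> mem_captured (encode_mem s E D) = E"
  "finite D \<Longrightarrow> mem_cover (encode_mem s E D) = D"
  by (simp_all add: encode_mem_def mem_out_def mem_captured_def mem_cover_def)

context
  fixes r J :: nat and \<beta> :: real and G :: network and mem :: "nat \<Rightarrow> nat option" and a :: nat
begin

definition residual :: "nat \<Rightarrow> nat set" where
  "residual j = {x \<in> hop_ball G (2 * j + 1) a. inp G x = 0} -
     (\<Union>b\<in>hop_ball G r a. case mem b of None \<Rightarrow> {} | Some m \<Rightarrow> mem_captured m)"

text \<open>Seen from a set node, elements lie at odd and sets at even distances. Every set
  containing an element within \<open>2 * j + 1\<close> lies within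
  \<open>2 * j + 2\<close>.\<close>

definition ball_covers :: "nat \<Rightarrow> nat set set" where
  "ball_covers j = covers (neighbors G) {b \<in> hop_ball G (2 * j + 2) a. inp G b = 1} (residual j)"

text \<open>The bound by \<open>J\<close> keeps the radius under control even if no \<open>j\<close> qualifies.\<close>

definition radius :: nat where
  "radius = min J (LEAST j. j \<le> J \<and>
     real (cost (ball_covers (Suc j))) \<le> \<beta> * real (cost (ball_covers j)))"

definition new_captured :: "nat set" where
  "new_captured = {x \<in> hop_ball G (2 * radius + 3) a. inp G x = 0}"

definition new_cover :: "nat set" where
  "new_cover = min_cover (ball_covers (Suc radius))"

text \<open>The output reflects the covers of this and of earlier centers only.
  \<open>sequential_cover\<close> shows that the sets selected in this way still cover
  everything.\<close>

definition grow_ball :: nat where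
  "grow_ball = (if inp G a = 1
     then encode_mem
       (a \<in> new_cover \<or> (\<exists>b\<in>hop_ball G r a. case mem b of None \<Rightarrow> False | Some m \<Rightarrow> a \<in> mem_cover m))
       new_captured new_cover
     else encode_mem False {} {})"

end

text \<open>The largest ball inspected for candidates belongs to index \<open>Suc J\<close> and has
  radius \<open>2 * J + 4\<close>.\<close>

lemma grow_ball_local:
  assumes agree: "agree r G G' a" and mem: "\<And>u. u \<in> hop_ball G r a \<Longrightarrow> mem u = mem' u"
    and r: "2 * J + 4 \<le> r"
  shows "grow_ball r J \<beta> G mem a = grow_ball r J \<beta> G' mem' a"
proof -
  have ball: "hop_ball G s a = hop_ball G' s a" if "s \<le> r" for s
    using agree_hop_ball[OF agree] that by simp
  have node: "neighbors G u = neighbors G' u" "inp G u = inp G' u" if "u \<in> hop_ball G s a" "s \<le> r" for u s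
    using agree that hop_ball_mono[OF that(2)] unfolding agree_def by blast+
  have elems: "{x \<in> hop_ball G s a. inp G x = i} = {x \<in> hop_ball G' s a. inp G' x = i}" if "s \<le> r" for s i
    using ball[OF that] node(2)[OF _ that] by auto
  have res: "residual r G mem a j = residual r G' mem' a j" if "j \<le> Suc J" for j
  proof -
    have captured: "(\<Union>b\<in>hop_ball G r a. case mem b of None \<Rightarrow> {} | Some m \<Rightarrow> mem_captured m) =
      (\<Union>b\<in>hop_ball G' r a. case mem' b of None \<Rightarrow> {} | Some m \<Rightarrow> mem_captured m)"
      using ball[of r] mem by auto
    have "2 * j + 1 \<le> r" using that r by simp
    then show ?thesis unfolding residual_def captured by (simp only: elems)
  qed
  have cov: "ball_covers r G mem a j = ball_covers r G' mem' a j" if "j \<le> Suc J" for j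
  proof -
    have le: "2 * j + 2 \<le> r" using that r by simp
    have "neighbors G ` D = neighbors G' ` D" if "D \<subseteq> {b \<in> hop_ball G (2 * j + 2) a. inp G b = 1}" for D
      using that node(1)[OF _ le] by (intro image_cong) auto
    then show ?thesis
      unfolding ball_covers_def covers_def elems[OF le, symmetric] res[OF that] by (auto 0 3)
  qed
  have rad: "radius r J \<beta> G mem a = radius r J \<beta> G' mem' a"
  proof -
    have "(\<lambda>j. j \<le> J \<and> real (cost (ball_covers r G mem a (Suc j))) \<le> \<beta> * real (cost (ball_covers r G mem a j))) =
      (\<lambda>j. j \<le> J \<and> real (cost (ball_covers r G' mem' a (Suc j))) \<le> \<beta> * real (cost (ball_covers r G' mem' a j)))"
      using cov by auto
    then show ?thesis unfolding radius_def by simp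
  qed
  have "radius r J \<beta> G mem a \<le> J" by (simp add: radius_def)
  then have "new_cover r J \<beta> G mem a = new_cover r J \<beta> G' mem' a"
    unfolding new_cover_def rad[symmetric] by (subst cov) auto
  moreover have "new_captured r J \<beta> G mem a = new_captured r J \<beta> G' mem' a"
    unfolding new_captured_def rad[symmetric] using \<open>radius r J \<beta> G mem a \<le> J\<close> r by (intro elems) simp
  moreover have "inp G a = inp G' a" using node(2)[of a 0] by simp
  moreover have "(\<exists>b\<in>hop_ball G r a. case mem b of None \<Rightarrow> False | Some m \<Rightarrow> a \<in> mem_cover m) \<longleftrightarrow>
      (\<exists>b\<in>hop_ball G' r a. case mem' b of None \<Rightarrow> False | Some m \<Rightarrow> a \<in> mem_cover m)"
    using ball[of r] mem by auto
  ultimately show ?thesis unfolding grow_ball_def by simp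
qed

section \<open>Analysis of a complete run of ball growing\<close>

lemma distinct_position:
  assumes "distinct xs"
  obtains f :: "'a \<Rightarrow> nat" where "inj_on f (set xs)" "sorted (map f xs)"
proof
  let ?f = "inv_into {..<length xs} ((!) xs)"
  have inj: "inj_on ((!) xs) {..<length xs}" using assms by (intro inj_on_nth) auto
  have "?f (xs ! i) = i" if "i < length xs" for i
    using inv_into_f_f[OF inj] that by simp
  then have "map ?f xs = [0..<length xs]" by (intro nth_equalityI) auto
  then show "sorted (map ?f xs)" by simp
  show "inj_on ?f (set xs)" by (rule inj_on_inv_into) (auto simp: set_conv_nth)
qed

lemma neighbors_set_node:
  assumes "set_cover_network G" "a \<in> set_nodes G"
  shows "neighbors G a \<subseteq> elem_nodes G"
proof
  fix x assume "x \<in> neighbors G a"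
  then have "{a, x} \<in> {{x, a} | x a. x \<in> elem_nodes G \<and> a \<in> set_nodes G}"
    using assms(1) by (auto simp: neighbors_def set_cover_network_def)
  then show "x \<in> elem_nodes G"
    using assms(2) by (auto simp: doubleton_eq_iff elem_nodes_def set_nodes_def)
qed

text \<open>An instance of \<open>sequential_cover\<close>: the centers are the set nodes, a center
  is charged for its residual at the chosen radius and captures all elements within two further
  hops.\<close>

lemma grow_ball_run:
  fixes \<beta> :: real
  defines "nb \<equiv> neighbors"
  assumes ok: "network_ok c G" and G: "set_cover_network G"
    and ord: "distinct order" "set order = verts G"
    and \<beta>: "\<beta> \<ge> 1" and J: "size_of G \<le> J \<or> real (size_of G) < \<beta> ^ J"
    and r: "r = 4 * J + 8"
    and A: "\<And>mem v. s_process A (view_of G R mem v) = grow_ball r J \<beta> G mem v"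
  defines "W \<equiv> {a \<in> set_nodes G. mem_out (the (slocal_run A R G order a)) = 1}"
  shows "elem_nodes G \<subseteq> \<Union>(nb G ` W)"
    and "D \<subseteq> set_nodes G \<Longrightarrow> elem_nodes G \<subseteq> \<Union>(nb G ` D) \<Longrightarrow> real (card W) \<le> \<beta> * real (card D)"
proof -
  obtain f :: "nat \<Rightarrow> nat" where f: "inj_on f (verts G)" "sorted (map f order)"
    using distinct_position[OF ord(1)] ord(2) by metis
  let ?S = "set_nodes G"
  have SV: "?S \<subseteq> verts G" by (auto simp: set_nodes_def)
  have finS: "finite ?S" using SV finite_verts[OF ok] finite_subset by blast
  have fin_ball: "finite (hop_ball G s a)" if "a \<in> ?S" for s a
    using hop_ball_subset_verts[OF ok] finite_verts[OF ok] SV that finite_subset by blast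
  define run where "run = slocal_run A R G order"
  define bef where "bef = (\<lambda>a u. if u \<in> verts G \<and> f u < f a then run u else None)"
  have run: "run a = Some (grow_ball r J \<beta> G (bef a) a)" if "a \<in> verts G" for a
    using slocal_run_sorted[OF ord(1) f(2), of a A R G] f(1) that ord(2) unfolding run_def bef_def A by simp
  define res where "res = (\<lambda>a. residual r G (bef a) a)"
  define cov where "cov = (\<lambda>a. ball_covers r G (bef a) a)"
  define rad where "rad = (\<lambda>a. radius r J \<beta> G (bef a) a)"
  define cp where "cp = (\<lambda>a. new_captured r J \<beta> G (bef a) a)"
  define ch where "ch = (\<lambda>a. new_cover r J \<beta> G (bef a) a)"
  have rad_le: "rad a \<le> J" for a by (simp add: rad_def radius_def)
  have cands: "{b \<in> hop_ball G s a. inp G b = 1} \<subseteq> ?S" if "a \<in> ?S" for s a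
    using hop_ball_subset_verts[OF ok] SV that by (auto simp: set_nodes_def)
  have elems: "{x \<in> hop_ball G s a. inp G x = 0} = elem_nodes G \<inter> hop_ball G s a" if "a \<in> ?S" for s a
    using hop_ball_subset_verts[OF ok] SV that by (auto simp: elem_nodes_def)
  \<comment> \<open>Ensures that the families of candidate covers are nonempty, so that their minima
    are attained.\<close>
  have coverable: "res a j \<subseteq> \<Union>(neighbors G ` {b \<in> hop_ball G (2 * j + 2) a. inp G b = 1})"
    if a: "a \<in> ?S" for a j
  proof
    fix x assume "x \<in> res a j"
    then have x: "x \<in> elem_nodes G" "x \<in> hop_ball G (2 * j + 1) a"
      using elems[OF a] by (auto simp: res_def residual_def)
    have "elem_nodes G = \<Union>(neighbors G ` ?S)" using G by (simp add: set_cover_network_def)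
    with x(1) obtain b where b: "b \<in> ?S" "x \<in> neighbors G b" by blast
    then have "b \<in> hop_ball G (2 * j + 1 + Suc 0) a"
      using hop_ball_trans[OF x(2) neighbors_hop_ball] neighbors_sym by metis
    then show "x \<in> \<Union>(neighbors G ` {b \<in> hop_ball G (2 * j + 2) a. inp G b = 1})"
      using b by (auto simp: set_nodes_def)
  qed
  have cov_eq: "cov a j = covers (neighbors G) {b \<in> hop_ball G (2 * j + 2) a. inp G b = 1} (res a j)" for a j
    by (simp add: cov_def ball_covers_def res_def)
  have best: "min_cover (cov a j) \<in> cov a j" "card (min_cover (cov a j)) = cost (cov a j)"
    "\<And>D. D \<in> cov a j \<Longrightarrow> cost (cov a j) \<le> card D" if "a \<in> ?S" for a j
    using min_cover_in[OF _ coverable[OF that], of j] card_min_cover[OF _ coverable[OF that], of j]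
      cost_le[OF _ coverable[OF that], of j] fin_ball[OF that] unfolding cov_eq by simp_all
  have ch_in: "ch a \<in> cov a (Suc (rad a))" if "a \<in> ?S" for a
    using best(1)[OF that] by (simp add: ch_def new_cover_def cov_def rad_def)
  have ch_near: "ch a \<subseteq> {b \<in> hop_ball G (2 * Suc (rad a) + 2) a. inp G b = 1}" if "a \<in> ?S" for a
    using ch_in[OF that] unfolding cov_eq by (simp add: covers_def)
  have ch_S: "ch a \<subseteq> ?S" if "a \<in> ?S" for a
    using ch_near[OF that] cands[OF that] by blast
  have cp_eq: "cp a = elem_nodes G \<inter> hop_ball G (2 * rad a + 3) a" if "a \<in> ?S" for a
    using elems[OF that] by (simp add: cp_def new_captured_def rad_def)
  have fin: "finite (cp a)" "finite (ch a)" if "a \<in> ?S" for a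
    using cp_eq[OF that] ch_S[OF that] fin_ball[OF that] finS finite_subset by auto
  have mem: "mem_captured (the (run a)) = (if a \<in> ?S then cp a else {})"
    "mem_cover (the (run a)) = (if a \<in> ?S then ch a else {})" if "a \<in> verts G" for a
    using run[OF that] fin[of a] that by (auto simp: grow_ball_def set_nodes_def cp_def ch_def)
  define C where "C = (\<lambda>a. \<Union>b\<in>{b\<in>?S. f b < f a}. cp b)"
  have res_eq: "res a j = elem_nodes G \<inter> hop_ball G (2 * j + 1) a - C a"
    if a: "a \<in> ?S" and j: "j \<le> Suc J" for a j
  proof -
    have "x \<in> C a \<longleftrightarrow> x \<in> (\<Union>b\<in>hop_ball G r a. case bef a b of None \<Rightarrow> {} | Some m \<Rightarrow> mem_captured m)"
      if x: "x \<in> hop_ball G (2 * j + 1) a" for x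
    proof
      assume "x \<in> C a"
      then obtain b where b: "b \<in> ?S" "f b < f a" "x \<in> cp b" by (auto simp: C_def)
      then have "b \<in> hop_ball G (2 * rad b + 3) x" using cp_eq hop_ball_sym by blast
      \<comment> \<open>Both \<open>a\<close> and \<open>b\<close> are within 2J + 3 of
        \<open>x\<close>, so \<open>b\<close> is within 4J + 6 of \<open>a\<close> and its memory is
        visible from \<open>a\<close>.\<close>
      from hop_ball_trans[OF x this] have "b \<in> hop_ball G r a"
        using hop_ball_mono[of "2 * j + 1 + (2 * rad b + 3)" r G a] j rad_le[of b] r by auto
      moreover have "bef a b = Some (the (run b))" using b SV run[of b] by (auto simp: bef_def)
      moreover have "x \<in> mem_captured (the (run b))" using b SV mem(1)[of b] by auto
      ultimately show "x \<in> (\<Union>b\<in>hop_ball G r a. case bef a b of None \<Rightarrow> {} | Some m \<Rightarrow> mem_captured m)"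
        by fastforce
    next
      assume "x \<in> (\<Union>b\<in>hop_ball G r a. case bef a b of None \<Rightarrow> {} | Some m \<Rightarrow> mem_captured m)"
      then obtain b m where b: "bef a b = Some m" "x \<in> mem_captured m" by (auto split: option.splits)
      then have "b \<in> verts G" "f b < f a" "m = the (run b)" by (auto simp: bef_def split: if_splits)
      then show "x \<in> C a" using b(2) mem(1)[of b] by (auto simp: C_def split: if_splits)
    qed
    then show ?thesis unfolding res_def residual_def elems[OF a] by blast
  qed
  have W: "W = {a \<in> ?S. \<exists>b\<in>?S. f b \<le> f a \<and> a \<in> ch b}"
  proof -
    have "mem_out (the (run a)) = 1 \<longleftrightarrow> (\<exists>b\<in>?S. f b \<le> f a \<and> a \<in> ch b)" if a: "a \<in> ?S" for a
    proof -
      have "mem_out (the (run a)) = 1 \<longleftrightarrow> a \<in> ch a \<or>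
        (\<exists>b\<in>hop_ball G r a. case bef a b of None \<Rightarrow> False | Some m \<Rightarrow> a \<in> mem_cover m)"
        using run[of a] a SV by (auto simp: grow_ball_def set_nodes_def ch_def)
      also have "\<dots> \<longleftrightarrow> (\<exists>b\<in>?S. f b \<le> f a \<and> a \<in> ch b)"
      proof
        assume "a \<in> ch a \<or> (\<exists>b\<in>hop_ball G r a. case bef a b of None \<Rightarrow> False | Some m \<Rightarrow> a \<in> mem_cover m)"
        then show "\<exists>b\<in>?S. f b \<le> f a \<and> a \<in> ch b"
        proof
          assume "\<exists>b\<in>hop_ball G r a. case bef a b of None \<Rightarrow> False | Some m \<Rightarrow> a \<in> mem_cover m"
          then obtain b m where b: "bef a b = Some m" "a \<in> mem_cover m" by (auto split: option.splits)
          then have "b \<in> verts G" "f b < f a" "m = the (run b)" by (auto simp: bef_def split: if_splits)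
          then show ?thesis using b(2) mem(2)[of b] by (auto split: if_splits intro!: bexI[of _ b])
        qed (use a in auto)
      next
        assume "\<exists>b\<in>?S. f b \<le> f a \<and> a \<in> ch b"
        then obtain b where b: "b \<in> ?S" "f b \<le> f a" "a \<in> ch b" by blast
        show "a \<in> ch a \<or> (\<exists>b\<in>hop_ball G r a. case bef a b of None \<Rightarrow> False | Some m \<Rightarrow> a \<in> mem_cover m)"
        proof (cases "b = a")
          case False
          then have "f b < f a" using b f(1) a SV by (auto simp: le_less dest: inj_onD)
          then have "bef a b = Some (the (run b))" using b SV run[of b] by (auto simp: bef_def)
          moreover have "a \<in> mem_cover (the (run b))" using b SV mem(2)[of b] by auto
          \<comment> \<open>A chosen set lies within 2J + 4 of the center that chose it, so it can
            read the choice there.\<close>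
          moreover have "b \<in> hop_ball G (2 * Suc (rad b) + 2) a"
            using ch_near[OF b(1)] b(3) hop_ball_sym by blast
          then have "b \<in> hop_ball G r a"
            using hop_ball_mono[of "2 * Suc (rad b) + 2" r G a] rad_le[of b] r by auto
          ultimately show ?thesis by fastforce
        qed (use b in simp)
      qed
      finally show ?thesis .
    qed
    then show ?thesis unfolding W_def run_def by blast
  qed
  have own: "neighbors G a \<subseteq> cp a" if a: "a \<in> ?S" for a
  proof
    fix x assume x: "x \<in> neighbors G a"
    then have "x \<in> hop_ball G (2 * rad a + 3) a"
      using neighbors_hop_ball[OF x] hop_ball_mono[of "Suc 0" "2 * rad a + 3" G a] by auto
    then show "x \<in> cp a" using x neighbors_set_node[OF G a] cp_eq[OF a] by blast
  qed
  have closed: "neighbors G d \<subseteq> cp a"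
    if a: "a \<in> ?S" and d: "d \<in> ?S" and meet: "neighbors G d \<inter> res a (rad a) \<noteq> {}" for a d
  proof
    fix x assume x: "x \<in> neighbors G d"
    from meet obtain y where y: "y \<in> neighbors G d" "y \<in> hop_ball G (2 * rad a + 1) a"
      using res_eq[OF a] rad_le[of a] by auto
    then have "d \<in> hop_ball G (2 * rad a + 1 + Suc 0) a"
      using hop_ball_trans[OF y(2) neighbors_hop_ball] neighbors_sym by metis
    from hop_ball_trans[OF this neighbors_hop_ball[OF x]]
    have "x \<in> hop_ball G (2 * rad a + 3) a" by (simp add: eval_nat_numeral)
    then show "x \<in> cp a" using x neighbors_set_node[OF G d] cp_eq[OF a] by blast
  qed
  have pay: "real (card (ch a)) \<le> \<beta> * real (card D)"
    if a: "a \<in> ?S" and D: "D \<subseteq> ?S" "res a (rad a) \<subseteq> \<Union>(neighbors G ` D)" for a D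
  proof -
    let ?P = "\<lambda>j. j \<le> J \<and> real (cost (cov a (Suc j))) \<le> \<beta> * real (cost (cov a j))"
    have "cost (cov a j) \<le> size_of G" for j
    proof -
      have "min_cover (cov a j) \<subseteq> verts G"
        using best(1)[OF a, of j] cands[OF a] SV unfolding cov_eq by (fastforce simp: covers_def)
      then show ?thesis using best(2)[OF a, of j] card_mono[OF finite_verts[OF ok]] by metis
    qed
    then have "\<exists>j. ?P j" using bounded_growth[of "\<lambda>j. cost (cov a j)", OF _ \<beta> J] by blast
    then have P: "?P (LEAST j. ?P j)" by (rule LeastI_ex)
    \<comment> \<open>\<open>bounded_growth\<close> supplies a witness up to \<open>J\<close>, so
      the truncation in \<open>radius\<close> leaves the least one unchanged.\<close>
    moreover have "rad a = (LEAST j. ?P j)"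
      using P by (simp add: rad_def radius_def cov_def)
    ultimately have "?P (rad a)" by simp
    moreover have "card (ch a) = cost (cov a (Suc (rad a)))"
      using best(2)[OF a] by (simp add: ch_def new_cover_def cov_def rad_def)
    ultimately have le: "real (card (ch a)) \<le> \<beta> * real (cost (cov a (rad a)))" by simp
    \<comment> \<open>Only sets this close can contain a residual element, so an arbitrary cover can
      be compared with the local optimum after restriction to them.\<close>
    let ?D = "D \<inter> {b \<in> hop_ball G (2 * rad a + 2) a. inp G b = 1}"
    have "res a (rad a) \<subseteq> \<Union>(neighbors G ` ?D)"
    proof
      fix x assume x: "x \<in> res a (rad a)"
      then obtain d where d: "d \<in> D" "x \<in> neighbors G d" using D(2) by blast
      have "x \<in> hop_ball G (2 * rad a + 1) a" using x res_eq[OF a] rad_le[of a] by auto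
      then have "d \<in> hop_ball G (2 * rad a + 1 + Suc 0) a"
        using d(2) hop_ball_trans neighbors_hop_ball neighbors_sym by metis
      then show "x \<in> \<Union>(neighbors G ` ?D)" using d D(1) by (auto simp: set_nodes_def)
    qed
    then have "?D \<in> cov a (rad a)" unfolding cov_eq covers_def by blast
    then have "cost (cov a (rad a)) \<le> card ?D" by (rule best(3)[OF a])
    also have "\<dots> \<le> card D" using D(1) finS finite_subset by (intro card_mono) auto
    finally have "\<beta> * real (cost (cov a (rad a))) \<le> \<beta> * real (card D)"
      using \<beta> by (intro mult_left_mono) simp_all
    then show ?thesis using le by simp
  qed
  have disj: "res a (rad a) \<inter> C a = {}" if "a \<in> ?S" for a
    using res_eq[OF that] rad_le[of a] by auto
  have covered: "cp a - C a \<subseteq> \<Union>(neighbors G ` ch a)" if a: "a \<in> ?S" for a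
  proof -
    \<comment> \<open>The captured radius 2 rad + 3 is the residual radius 2(rad + 1) + 1 of the
      next index, whose optimal cover was selected.\<close>
    have "cp a - C a = res a (Suc (rad a))"
      using res_eq[OF a, of "Suc (rad a)"] rad_le[of a] cp_eq[OF a] by (simp add: numeral_eq_Suc)
    then show ?thesis using ch_in[OF a] unfolding cov_eq by (simp add: covers_def)
  qed
  note seq = sequential_cover[of ?S f "neighbors G" cp "\<lambda>a. res a (rad a)" ch \<beta>,
    OF finS inj_on_subset[OF f(1) SV] own closed disj[unfolded C_def] ch_S covered[unfolded C_def] pay,
    folded W]
  have "elem_nodes G = \<Union>(neighbors G ` ?S)" using G by (simp add: set_cover_network_def)
  then show "elem_nodes G \<subseteq> \<Union>(nb G ` W)" using seq(1) \<beta> unfolding nb_def by simp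
  show "real (card W) \<le> \<beta> * real (card D)"
    if D: "D \<subseteq> ?S" "elem_nodes G \<subseteq> \<Union>(nb G ` D)"
  proof (rule seq(2))
    show "0 \<le> \<beta>" using \<beta> by simp
    show "D \<subseteq> ?S" by (rule D)
    show "res a (rad a) \<subseteq> \<Union>(neighbors G ` D)" if "a \<in> ?S" for a
      using res_eq[OF that] rad_le[of a] D(2) unfolding nb_def by auto
  qed
qed

lemma min_cover_size_attained:
  assumes "finite S" "\<Union>S = X"
  obtains C where "set_cover X S C" "card C = min_cover_size X S"
proof -
  have "finite {C. set_cover X S C}"
    by (rule finite_subset[of _ "Pow S"]) (use assms(1) in \<open>auto simp: set_cover_def\<close>)
  moreover have "set_cover X S S" using assms(2) by (simp add: set_cover_def)
  ultimately have "min_cover_size X S \<in> card ` {C. set_cover X S C}"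
    unfolding min_cover_size_def by (intro Min_in) auto
  then show ?thesis using that by auto
qed

text \<open>Growth is run with \<open>max 1 \<alpha>\<close>. The two factors can differ only below
  two nodes, where there are no elements and the optimum is 0.\<close>

lemma grow_ball_approx:
  fixes \<alpha> :: real
  assumes ok: "network_ok c G" and G: "set_cover_network G"
    and ord: "distinct order" "set order = verts G"
    and \<alpha>: "size_of G \<ge> 2 \<Longrightarrow> \<alpha> \<ge> 1"
    and J: "size_of G \<le> J \<or> real (size_of G) < max 1 \<alpha> ^ J"
    and r: "r = 4 * J + 8"
    and A: "\<And>mem v. s_process A (view_of G R mem v) = grow_ball r J (max 1 \<alpha>) G mem v"
      "s_out A = mem_out"
  shows "approx_set_cover \<alpha> (elem_nodes G) (neighbors G ` set_nodes G)
    (neighbors G ` {a \<in> set_nodes G. slocal_output A R G order a = 1})"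
proof -
  let ?S = "set_nodes G" and ?nb = "neighbors G"
  define W where "W = {a \<in> ?S. slocal_output A R G order a = 1}"
  have W_eq: "W = {a \<in> ?S. mem_out (the (slocal_run A R G order a)) = 1}"
    by (auto simp: W_def slocal_output_def set_nodes_def A(2))
  note run = grow_ball_run[OF ok G ord _ J r A(1), folded W_eq]
  have S: "\<Union>(?nb ` ?S) = elem_nodes G" "inj_on ?nb ?S" using G by (simp_all add: set_cover_network_def)
  have fin: "finite ?S" by (rule finite_subset[OF _ finite_verts[OF ok]]) (auto simp: set_nodes_def)
  have "W \<subseteq> ?S" by (auto simp: W_def)
  then have cover: "set_cover (elem_nodes G) (?nb ` ?S) (?nb ` W)"
    using run(1) S(1) unfolding set_cover_def by fastforce
  obtain C where C: "set_cover (elem_nodes G) (?nb ` ?S) C"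
    "card C = min_cover_size (elem_nodes G) (?nb ` ?S)"
    using min_cover_size_attained[of "?nb ` ?S"] fin S(1) by blast
  \<comment> \<open>The optimum is a family of sets while the charging counts set nodes; injectivity
    of the neighborhoods on set nodes makes the two sizes equal.\<close>
  then obtain D where D: "D \<subseteq> ?S" "C = ?nb ` D" unfolding set_cover_def by (auto elim: subset_imageE)
  have card_D: "card C = card D" unfolding D(2) by (rule card_image[OF inj_on_subset[OF S(2) D(1)]])
  have "real (card (?nb ` W)) \<le> real (card W)"
    using finite_subset[OF \<open>W \<subseteq> ?S\<close> fin] card_image_le by (intro of_nat_mono) blast
  also have "\<dots> \<le> max 1 \<alpha> * real (card D)"
    using run(2)[OF _ D(1)] C(1) unfolding set_cover_def D(2) by auto
  finally have le: "real (card (?nb ` W)) \<le> max 1 \<alpha> * real (card C)" by (simp only: card_D)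
  have "real (card (?nb ` W)) \<le> \<alpha> * real (card C)"
  proof (cases "size_of G \<ge> 2")
    case True
    then show ?thesis using le \<alpha> by (simp add: max_def split: if_splits)
  next
    case False
    have "elem_nodes G = {}"
    proof (rule ccontr)
      assume "elem_nodes G \<noteq> {}"
      then obtain x a where xa: "x \<in> elem_nodes G" "a \<in> ?S" using S(1) by blast
      then have "x \<noteq> a" "{x, a} \<subseteq> verts G" by (auto simp: elem_nodes_def set_nodes_def)
      then show False using False card_mono[OF finite_verts[OF ok], of "{x, a}"] by simp
    qed
    then have "set_cover (elem_nodes G) (?nb ` ?S) {}" by (simp add: set_cover_def)
    moreover have "finite {C. set_cover (elem_nodes G) (?nb ` ?S) C}"
      by (rule finite_subset[of _ "Pow (?nb ` ?S)"]) (use fin in \<open>auto simp: set_cover_def\<close>)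
    ultimately have "min_cover_size (elem_nodes G) (?nb ` ?S) \<le> card ({} :: nat set set)"
      unfolding min_cover_size_def by (intro Min_le) (auto intro!: image_eqI[of _ card "{}"])
    then have "card C = 0" using C(2) by simp
    then show ?thesis using le by simp
  qed
  then show ?thesis using cover C(2) unfolding approx_set_cover_def W_def by simp
qed

theorem set_cover_problem_in_P_SLOCAL:
  fixes \<alpha> :: "nat \<Rightarrow> real"
  assumes ge_1: "\<And>n. n \<ge> 2 \<Longrightarrow> \<alpha> n \<ge> 1"
    and ev: "\<forall>\<^sub>F n in sequentially. \<alpha> n \<ge> 1 + 1 / ln (real n) ^ k"
  shows "set_cover_problem \<alpha> \<in> P_SLOCAL"
  unfolding P_SLOCAL_def
proof (intro CollectI allI)
  fix c
  have "\<forall>\<^sub>F n in sequentially. max 1 (\<alpha> n) \<ge> 1 + 1 / ln (real n) ^ k"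
    using ev by eventually_elim (simp add: le_max_iff_disj)
  then obtain J where J: "polylog (\<lambda>n. real (J n))"
    "\<And>n. n \<le> J n \<or> real n < max 1 (\<alpha> n) ^ J n"
    by (rule growth_depth) blast
  define r where "r = (\<lambda>n. 4 * J n + 8)"
  define F where "F = (\<lambda>G. grow_ball (r (size_of G)) (J (size_of G)) (max 1 (\<alpha> (size_of G))) G)"
  obtain p where p: "\<And>G mem v. p (view_of G (Suc (r (size_of G))) mem v) = F G mem v"
  proof (rule slocal_realizable[of r F])
    fix G G' :: network and mem mem' :: "nat \<Rightarrow> nat option" and v
    assume agree: "agree (r (size_of G)) G G' v"
      and mem: "\<And>u. u \<in> hop_ball G (r (size_of G)) v \<Longrightarrow> mem u = mem' u"
    have "size_of G = size_of G'" using agree by (simp add: agree_def)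
    moreover have "grow_ball (r (size_of G)) (J (size_of G)) (max 1 (\<alpha> (size_of G))) G mem v =
        grow_ball (r (size_of G)) (J (size_of G)) (max 1 (\<alpha> (size_of G))) G' mem' v"
      by (rule grow_ball_local[OF agree mem]) (simp_all add: r_def)
    ultimately show "F G mem v = F G' mem' v" by (simp add: F_def)
  qed blast
  define A where "A = \<lparr>s_process = p, s_out = mem_out\<rparr>"
  have "slocal_solves c A (\<lambda>n. Suc (r n)) (set_cover_problem \<alpha>)"
    unfolding slocal_solves_def
  proof (intro allI impI, elim conjE)
    fix G order
    assume "network_ok c G" "admissible (set_cover_problem \<alpha>) G" "distinct order" "set order = verts G"
    then show "solution (set_cover_problem \<alpha>) G (slocal_output A (Suc (r (size_of G))) G order)"
      using grow_ball_approx[of c G order "\<alpha> (size_of G)" "J (size_of G)" "r (size_of G)" A "Suc (r (size_of G))"]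
        ge_1 J(2) p by (simp add: set_cover_problem_def A_def r_def F_def)
  qed
  moreover have "polylog (\<lambda>n. real (Suc (r n)))"
    unfolding r_def of_nat_Suc of_nat_add of_nat_mult
    by (intro polylog_add polylog_mult polylog_const J(1))
  ultimately show "\<exists>A R. polylog (\<lambda>n. real (R n)) \<and> slocal_solves c A R (set_cover_problem \<alpha>)"
    by (intro exI conjI)
qed

text \<open>The excess of \<alpha> over 1 keeps the ball radius polylogarithmic. A bound of at least
  1 is required wherever an element is present, since the optimum is then positive and no cover is
  smaller. Hardness follows from the inclusion of P-SLOCAL in P-LOCAL.\<close>

theorem theorem7p5:
  fixes \<alpha> :: "nat \<Rightarrow> real"
  assumes "polylog \<alpha>"
    and "\<And>n. n \<ge> 2 \<Longrightarrow> \<alpha> n \<ge> 1"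
    and "\<exists>k::nat. \<forall>\<^sub>F n in sequentially. \<alpha> n \<ge> 1 + 1 / ln (real n) ^ k"
  shows "P_SLOCAL_complete (set_cover_problem \<alpha>)"
  using assms(2,3) set_cover_problem_in_P_SLOCAL P_SLOCAL_subset_P_LOCAL
  unfolding P_SLOCAL_complete_def by blast

end
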